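(* There is an absolute constant $C>0$ such that the following holds. For every integer $k\geq2$ and any real number $\gamma$ satisfying $(k-1)^{2}+1\leq\gamma\leq R(k)$, there is a graph $G$ with $\chi(G)=k$ such that $$C\gamma\cdot\max\left\{\frac{\log\gamma}{k\log k},\,\left(\frac{\log\gamma}{k}\right)^{2}\right\}<R_{\chi}(G)\leq\gamma.$$
   Context: All logarithms are taken base $2$. All graphs are finite and simple. $\chi(G)$ is the chromatic number of $G$. $R(k)$ is the classical Ramsey number: the smallest integer $N$ such that any $2$-coloring of the edges of the clique $K_N$ results in a monochromatic copy of the clique $K_k$. A copy of $G$ is a graph obtained by relabeling the vertices of $G$; copies are sought as (not necessarily induced) subgraphs. For a graph $G$ containing at least one edge, the chromatic Ramsey number $R_{\chi}(G)$ is the smallest integer $N$ such that there exists a graph $F$ with $\chi(F)=N$ for which every $2$-coloring of the edges of $F$ results in a monochromatic copy of $G$. *)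

theory Defs
  imports Complex_Main "HOL-Library.Ramsey"
begin

text \<open>
  A graph is given by a vertex set \<open>V\<close> and a set \<open>E\<close> of two-element subsets of \<open>V\<close>;
  \<open>[V]\<^bsup>2\<^esup>\<close> is the notation of \<^theory>\<open>HOL-Library.Ramsey\<close> for the set of all such subsets.
\<close>

definition simple_graph :: "'a set \<Rightarrow> 'a set set \<Rightarrow> bool" where
  "simple_graph V E \<longleftrightarrow> finite V \<and> E \<subseteq> [V]\<^bsup>2\<^esup>"

definition proper_colouring :: "'a set \<Rightarrow> 'a set set \<Rightarrow> nat \<Rightarrow> ('a \<Rightarrow> nat) \<Rightarrow> bool" where
  "proper_colouring V E n c \<longleftrightarrow>
     c \<in> V \<rightarrow> {..<n} \<and> (\<forall>u\<in>V. \<forall>v\<in>V. {u, v} \<in> E \<longrightarrow> c u \<noteq> c v)"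

definition chromatic_number :: "'a set \<Rightarrow> 'a set set \<Rightarrow> nat" where
  "chromatic_number V E = (LEAST n. \<exists>c. proper_colouring V E n c)"

definition graph_copy :: "'b set \<Rightarrow> 'b set set \<Rightarrow> 'a set \<Rightarrow> 'a set set \<Rightarrow> bool" where
  "graph_copy V' E' V E \<longleftrightarrow> (\<exists>\<phi>. bij_betw \<phi> V V' \<and> E' = (`) \<phi> ` E)"

text \<open>
  The host graph is \<open>(W, D)\<close>, the target graph is \<open>(V, E)\<close>. Edges of the host between
  vertices of the copy are not required to be edges of the copy: copies need not be induced.
\<close>

definition arrows :: "'b set \<Rightarrow> 'b set set \<Rightarrow> 'a set \<Rightarrow> 'a set set \<Rightarrow> bool" where
  "arrows W D V E \<longleftrightarrow>
     (\<forall>f \<in> D \<rightarrow> {..<2::nat}. \<exists>i<2. \<exists>V' E'.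
        graph_copy V' E' V E \<and> V' \<subseteq> W \<and> E' \<subseteq> D \<and> f ` E' \<subseteq> {i})"

text \<open>
  \<^const>\<open>partn\<close> says here that every map from the edges of the clique on \<open>{..<N}\<close> to the
  two colours \<open>{..<2}\<close> is constant on all pairs from some \<open>k\<close>-element subset.
\<close>

definition ramsey_number :: "nat \<Rightarrow> nat" where
  "ramsey_number k = (LEAST N. partn {..<N} k 2 {..<2::nat})"

text \<open>
  Every finite graph is isomorphic to one whose vertices are natural numbers, so it is no
  restriction to let the host graph \<open>(W, D)\<close> range over graphs of this kind.
\<close>

definition chromatic_ramsey_number :: "'a set \<Rightarrow> 'a set set \<Rightarrow> nat" where
  "chromatic_ramsey_number V E =
     (LEAST N. \<exists>(W :: nat set) D.
        simple_graph W D \<and> chromatic_number W D = N \<and> arrows W D V E)"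

text \<open>The three minima above are taken over nonempty sets.\<close>

lemma proper_colouring_exists:
  assumes "simple_graph V E"
  shows "\<exists>n c. proper_colouring V E n c"
proof -
  obtain c where c: "bij_betw c V {0..<card V}"
    using assms ex_bij_betw_finite_nat unfolding simple_graph_def by blast
  then have c': "inj_on c V" "c ` V = {..<card V}"
    by (auto simp: bij_betw_def lessThan_atLeast0)
  have "c u \<noteq> c v" if "u \<in> V" "v \<in> V" "{u, v} \<in> E" for u v
  proof -
    have "{u, v} \<in> [V]\<^bsup>2\<^esup>"
      using that(3) assms unfolding simple_graph_def by blast
    then have "u \<noteq> v" by simp
    then show ?thesis
      using c'(1) that(1,2) by (meson inj_onD)
  qed
  moreover have "c \<in> V \<rightarrow> {..<card V}"
    using c'(2) by blast
  ultimately have "proper_colouring V E (card V) c"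
    unfolding proper_colouring_def by blast
  then show ?thesis by blast
qed

lemma ramsey_number_exists: "\<exists>N::nat. partn {..<N} k 2 {..<2::nat}"
  using ramsey_full[of "[k, k]" 2] by (simp add: partn_lst_eq_partn)

lemma chromatic_ramsey_number_exists:
  assumes "simple_graph V E"
  shows "\<exists>N (W :: nat set) D. simple_graph W D \<and> chromatic_number W D = N \<and> arrows W D V E"
proof -
  obtain N :: nat where N: "partn {..<N} (card V) 2 {..<2::nat}"
    using ramsey_number_exists by blast
  have "arrows {..<N} ([{..<N}]\<^bsup>2\<^esup>) V E"
    unfolding arrows_def
  proof
    fix f :: "nat set \<Rightarrow> nat"
    assume "f \<in> [{..<N}]\<^bsup>2\<^esup> \<rightarrow> {..<2}"
    with N obtain i where i: "i < 2" and "monochromatic {..<N} (card V) 2 f i"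
      unfolding partn_def by auto
    then obtain H where H: "H \<in> [{..<N}]\<^bsup>card V\<^esup>"
      and mono: "f ` [H]\<^bsup>2\<^esup> \<subseteq> {i}"
      unfolding monochromatic_def by auto
    have "finite V" and E: "E \<subseteq> [V]\<^bsup>2\<^esup>"
      using assms by (auto simp: simple_graph_def)
    moreover have "finite H" "card H = card V" and HN: "H \<subseteq> {..<N}"
      using H by (auto simp: nsets_def)
    ultimately obtain \<phi> where \<phi>: "bij_betw \<phi> V H"
      by (metis finite_same_card_bij)
    then have sub: "(`) \<phi> ` E \<subseteq> [H]\<^bsup>2\<^esup>"
      using E bij_betw_nsets[OF \<phi>, of 2] by (auto simp: bij_betw_def)
    have "graph_copy H ((`) \<phi> ` E) V E"
      unfolding graph_copy_def using \<phi> by (intro exI[of _ \<phi>] conjI refl)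
    moreover have "(`) \<phi> ` E \<subseteq> [{..<N}]\<^bsup>2\<^esup>"
      using sub nsets_mono[OF HN, of 2] by (rule order_trans)
    moreover have "f ` (`) \<phi> ` E \<subseteq> {i}"
      using image_mono[OF sub] mono by (rule order_trans)
    ultimately show "\<exists>i<2. \<exists>V' E'. graph_copy V' E' V E \<and> V' \<subseteq> {..<N} \<and>
        E' \<subseteq> [{..<N}]\<^bsup>2\<^esup> \<and> f ` E' \<subseteq> {i}"
      using i HN by metis
  qed
  moreover have "simple_graph {..<N} ([{..<N}]\<^bsup>2\<^esup>)"
    by (simp add: simple_graph_def)
  ultimately show ?thesis by blast
qed

end

theory Submission
  imports Defs "HOL-Library.Nat_Bijection"
begin

text \<open>
  Write \<open>X \<rightarrow> H\<close> if there is a homomorphism from \<open>X\<close> to \<open>H\<close>. By a blow-up argument, \<open>R\<^sub>\<chi>(G)\<close> is the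
  least \<open>N\<close> such that every 2-colouring of the edges of \<open>K\<^sub>N\<close> has a colour class receiving \<open>G\<close>.
  The theorem holds with the maximum replaced by a constant, which is stronger because
  \<open>R(k) \<le> 4\<^sup>k\<close>.

  Let \<open>N\<close> be the integer part of \<open>\<gamma>\<close>. It suffices to find some \<open>X \<rightarrow> K\<^sub>k\<close> that is unavoidable on
  \<open>N\<close> points but not on \<open>N / 25\<close> points. For then let \<open>G\<close> be the tensor product of all graphs on
  at most \<open>N\<close> points which receive \<open>X\<close> and have fractional chromatic number greater than
  \<open>k - 1\<close>. By the fractional version of Hedetniemi's conjecture (Zhu), \<open>G\<close> has chromatic number
  \<open>k\<close>. It is unavoidable on \<open>N\<close> points: in a colouring without monochromatic \<open>K\<^sub>k\<close> both colour
  classes have independence number less than \<open>k\<close>, hence fractional chromatic number at least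
  \<open>N / (k - 1) > k - 1\<close>, and one of them receives \<open>X\<close>.

  To find \<open>X\<close>, choose \<open>s\<close> with \<open>R(s) \<le> N < R(s + 1)\<close> and take \<open>X = K\<^sub>s\<^sub>+\<^sub>1 \<times> P\<close>, where every vertex of
  \<open>P\<close> lies in an \<open>s\<close>-clique. In a colouring without monochromatic \<open>K\<^sub>s\<^sub>+\<^sub>1\<close>, a colour class receives
  \<open>X\<close> if and only if it receives \<open>P\<close>, so the chromatic number of \<open>P\<close> need not be bounded by \<open>k\<close>,
  and \<open>P\<close> can be chosen to be extremal.
\<close>

section \<open>Graph homomorphisms\<close>

definition graph_hom :: "'a set \<Rightarrow> 'a set set \<Rightarrow> 'b set \<Rightarrow> 'b set set \<Rightarrow> ('a \<Rightarrow> 'b) \<Rightarrow> bool" where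
  "graph_hom V E W D \<phi> \<longleftrightarrow>
     \<phi> \<in> V \<rightarrow> W \<and> (\<forall>u\<in>V. \<forall>v\<in>V. {u, v} \<in> E \<longrightarrow> {\<phi> u, \<phi> v} \<in> D)"

definition maps_to :: "'a set \<Rightarrow> 'a set set \<Rightarrow> 'b set \<Rightarrow> 'b set set \<Rightarrow> bool" where
  "maps_to V E W D \<longleftrightarrow> (\<exists>\<phi>. graph_hom V E W D \<phi>)"

lemma maps_to_trans: "maps_to V E W D \<Longrightarrow> maps_to W D X F \<Longrightarrow> maps_to V E X F"
  unfolding maps_to_def
proof (elim exE)
  fix \<phi> \<psi> assume "graph_hom V E W D \<phi>" "graph_hom W D X F \<psi>"
  then have "graph_hom V E X F (\<psi> \<circ> \<phi>)"
    unfolding graph_hom_def by (auto simp: Pi_iff)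
  then show "\<exists>\<phi>. graph_hom V E X F \<phi>" by blast
qed

lemma maps_to_subgraph: "V \<subseteq> W \<Longrightarrow> E \<subseteq> D \<Longrightarrow> maps_to V E W D"
  unfolding maps_to_def graph_hom_def by (intro exI[of _ id]) auto

lemma simple_graph_finite: "simple_graph V E \<Longrightarrow> finite V"
  by (simp add: simple_graph_def)

lemma simple_graph_edge:
  "simple_graph V E \<Longrightarrow> {u, v} \<in> E \<Longrightarrow> u \<in> V \<and> v \<in> V \<and> u \<noteq> v"
  unfolding simple_graph_def by (metis doubleton_in_nsets_2 subsetD)

lemma simple_graph_complete [simp]: "finite V \<Longrightarrow> simple_graph V ([V]\<^bsup>2\<^esup>)"
  by (simp add: simple_graph_def)

lemma chromatic_number_le_iff:
  assumes "simple_graph V E"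
  shows "chromatic_number V E \<le> n \<longleftrightarrow> maps_to V E {..<n} ([{..<n}]\<^bsup>2\<^esup>)"
proof -
  have col: "(\<exists>c. proper_colouring V E m c) \<longleftrightarrow> maps_to V E {..<m} ([{..<m}]\<^bsup>2\<^esup>)" for m
    unfolding maps_to_def graph_hom_def proper_colouring_def
    by (auto simp: Pi_iff)
  have "maps_to V E {..<chromatic_number V E} ([{..<chromatic_number V E}]\<^bsup>2\<^esup>)"
    unfolding col[symmetric] chromatic_number_def
    by (rule LeastI_ex) (rule proper_colouring_exists[OF assms])
  moreover have "maps_to {..<m} ([{..<m}]\<^bsup>2\<^esup>) {..<n} ([{..<n}]\<^bsup>2\<^esup>)" if "m \<le> n" for m n :: nat
    using that by (intro maps_to_subgraph nsets_mono) auto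
  ultimately have "maps_to V E {..<n} ([{..<n}]\<^bsup>2\<^esup>)" if "chromatic_number V E \<le> n"
    using that maps_to_trans by blast
  moreover have "chromatic_number V E \<le> n" if "maps_to V E {..<n} ([{..<n}]\<^bsup>2\<^esup>)"
    unfolding chromatic_number_def by (rule Least_le) (use that col in blast)
  ultimately show ?thesis by blast
qed

lemma maps_to_complete:
  assumes "simple_graph V E" "finite W" "maps_to V E W D" "D \<subseteq> [W]\<^bsup>2\<^esup>"
  shows "chromatic_number V E \<le> card W"
proof -
  obtain c where "bij_betw c W {0..<card W}"
    using assms(2) ex_bij_betw_finite_nat by blast
  then have "graph_hom W D {..<card W} ([{..<card W}]\<^bsup>2\<^esup>) c"
    using assms(4) unfolding graph_hom_def
    by (auto simp: bij_betw_def inj_on_def lessThan_atLeast0)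
  then have "maps_to W D {..<card W} ([{..<card W}]\<^bsup>2\<^esup>)"
    unfolding maps_to_def by blast
  then show ?thesis
    using assms chromatic_number_le_iff maps_to_trans by blast
qed

section \<open>Fractional lower bounds for the chromatic number\<close>

definition independent_set :: "'a set \<Rightarrow> 'a set set \<Rightarrow> 'a set \<Rightarrow> bool" where
  "independent_set V E I \<longleftrightarrow> I \<subseteq> V \<and> (\<forall>u\<in>I. \<forall>v\<in>I. {u, v} \<notin> E)"

text \<open>By linear programming duality, the fractional chromatic number of a nonempty finite
  simple graph is the largest ratio of the total weight to the maximal weight of an independent set.
  The weight \<open>g\<close> is not normalised.\<close>

definition fractional_chromatic_ge :: "real \<Rightarrow> 'a set \<Rightarrow> 'a set set \<Rightarrow> bool" where
  "fractional_chromatic_ge \<kappa> V E \<longleftrightarrow>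
     (\<exists>g. (\<forall>v\<in>V. 0 \<le> g v) \<and> 0 < sum g V \<and>
        (\<forall>I. independent_set V E I \<longrightarrow> \<kappa> * sum g I \<le> sum g V))"

text \<open>The classes of an optimal colouring partition \<open>V\<close> into independent sets;
  add up their weights.\<close>

lemma fractional_chromatic_ge_imp_chromatic_number:
  assumes sg: "simple_graph V E" and "fractional_chromatic_ge \<kappa> V E"
  shows "\<kappa> \<le> real (chromatic_number V E)"
proof -
  obtain g where g: "0 < sum g V" "\<And>I. independent_set V E I \<Longrightarrow> \<kappa> * sum g I \<le> sum g V"
    using assms(2) unfolding fractional_chromatic_ge_def by blast
  let ?n = "chromatic_number V E"
  obtain c where c: "graph_hom V E {..<?n} ([{..<?n}]\<^bsup>2\<^esup>) c"
    using chromatic_number_le_iff[OF sg, of ?n] unfolding maps_to_def by blast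
  have "independent_set V E {v \<in> V. c v = i}" for i
    using c unfolding graph_hom_def independent_set_def by fastforce
  then have le: "\<kappa> * sum g {v \<in> V. c v = i} \<le> sum g V" for i
    using g(2) by blast
  have "\<kappa> * sum g V = (\<Sum>i<?n. \<kappa> * sum g {v \<in> V. c v = i})"
    using c simple_graph_finite[OF sg] unfolding graph_hom_def
    by (subst sum.group[symmetric, of V "{..<?n}" c]) (auto simp: sum_distrib_left)
  also have "\<dots> \<le> (\<Sum>i<?n. sum g V)"
    by (intro sum_mono le)
  finally have "\<kappa> * sum g V \<le> real ?n * sum g V"
    by simp
  then show ?thesis
    using g(1) by simp
qed

text \<open>The weight is the indicator of \<open>T\<close>. Subsets \<open>T\<close> are allowed
  because \<open>large_fractional_subgraph\<close> controls independent sets only outside a removed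
  set.\<close>

lemma fractional_chromatic_ge_uniform:
  assumes "finite V" "T \<subseteq> V" "T \<noteq> {}"
    and "\<And>I. independent_set V E I \<Longrightarrow> \<kappa> * real (card (I \<inter> T)) \<le> real (card T)"
  shows "fractional_chromatic_ge \<kappa> V E"
  unfolding fractional_chromatic_ge_def
proof (intro exI[of _ "\<lambda>v. if v \<in> T then 1 else 0"] conjI ballI allI impI)
  have eq: "(\<Sum>v\<in>I. if v \<in> T then 1 else 0) = real (card (I \<inter> T))" if "I \<subseteq> V" for I
    using that assms(1) finite_subset by (subst sum.inter_restrict[symmetric]) auto
  show "0 < (\<Sum>v\<in>V. if v \<in> T then 1 else (0::real))"
    unfolding eq[OF order_refl] using assms(1-3)
    by (metis Int_absorb1 card_gt_0_iff finite_subset of_nat_0_less_iff)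
  fix I assume "independent_set V E I"
  moreover from this have "I \<subseteq> V" by (simp add: independent_set_def)
  ultimately show "\<kappa> * (\<Sum>v\<in>I. if v \<in> T then 1 else 0) \<le> (\<Sum>v\<in>V. if v \<in> T then 1 else 0)"
    using assms(2,4) by (simp add: eq Int_absorb1)
qed simp

definition closed_nbhd :: "'a set \<Rightarrow> 'a set set \<Rightarrow> 'a set \<Rightarrow> 'a set" where
  "closed_nbhd V E I = I \<union> {v \<in> V. \<exists>u\<in>I. {u, v} \<in> E}"

text \<open>
  If the inequality fails at \<open>I\<close>, then restricting the weight to the complement of the closed
  neighbourhood of \<open>I\<close> gives a weight with smaller support which still satisfies the hypothesis,
  since \<open>I \<union> J\<close> is independent for every independent \<open>J\<close> in the complement.
\<close>

lemma fractional_clique_neighbourhood: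
  assumes "finite V" "fractional_chromatic_ge \<kappa> V E"
  obtains g where "\<And>v. v \<in> V \<Longrightarrow> 0 \<le> g v" "0 < sum g V"
    "\<And>I. independent_set V E I \<Longrightarrow> \<kappa> * sum g I \<le> sum g (closed_nbhd V E I)"
proof -
  define ok where "ok g \<longleftrightarrow> (\<forall>v\<in>V. 0 \<le> g v) \<and> 0 < sum g V \<and>
      (\<forall>I. independent_set V E I \<longrightarrow> \<kappa> * sum g I \<le> sum g V)" for g
  define supp where "supp g = {v \<in> V. g v \<noteq> (0::real)}" for g
  \<comment> \<open>The support of \<open>g\<close> is minimal, so a failing inequality is refuted
    by a valid weight \<open>h\<close> of smaller support.\<close>
  obtain g where g: "ok g" and min: "\<And>h. ok h \<Longrightarrow> card (supp g) \<le> card (supp h)"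
    using ex_has_least_nat[of ok _ "\<lambda>g. card (supp g)"] assms(2)
    unfolding fractional_chromatic_ge_def ok_def by blast
  have fin: "finite I" if "I \<subseteq> V" for I
    using that assms(1) finite_subset by blast
  have nonneg: "0 \<le> sum g I" if "I \<subseteq> V" for I
    using that g unfolding ok_def by (intro sum_nonneg) auto
  have "\<kappa> * sum g I \<le> sum g (closed_nbhd V E I)" if I: "independent_set V E I" for I
  proof (rule ccontr)
    let ?N = "closed_nbhd V E I"
    assume viol: "\<not> \<kappa> * sum g I \<le> sum g ?N"
    have IV: "I \<subseteq> V" and NV: "?N \<subseteq> V" and IN: "I \<subseteq> ?N"
      using I by (auto simp: independent_set_def closed_nbhd_def)
    define h where "h v = (if v \<in> ?N then 0 else g v)" for v
    have sum_h: "sum h J = sum g (J - ?N)" if "J \<subseteq> V" for J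
    proof -
      have "sum h J = sum h (J - ?N)"
        using fin[OF that] by (intro sum.mono_neutral_right) (auto simp: h_def)
      also have "\<dots> = sum g (J - ?N)"
        by (rule sum.cong) (auto simp: h_def)
      finally show ?thesis .
    qed
    have split: "sum h V = sum g V - sum g ?N"
      using sum_h[OF order_refl] sum_diff[of V ?N g] fin NV by simp
    have "\<kappa> * sum g I \<le> sum g V"
      using g I unfolding ok_def by blast
    then have pos: "0 < sum h V"
      using viol split by linarith
    have indep_h: "\<kappa> * sum h J \<le> sum h V" if J: "independent_set V E J" for J
    proof -
      have JV: "J \<subseteq> V" using J by (simp add: independent_set_def)
      have "independent_set V E (I \<union> (J - ?N))"
        using I J unfolding independent_set_def closed_nbhd_def
        by (auto simp: insert_commute) (metis insert_commute)
      then have "\<kappa> * sum g (I \<union> (J - ?N)) \<le> sum g V"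
        using g unfolding ok_def by blast
      moreover have "sum g (I \<union> (J - ?N)) = sum g I + sum g (J - ?N)"
        using IN fin IV JV by (intro sum.union_disjoint) auto
      ultimately have "\<kappa> * sum g I + \<kappa> * sum h J \<le> sum g V"
        using sum_h[OF JV] by (simp add: algebra_simps)
      then show ?thesis using viol split by linarith
    qed
    have "ok h"
      using g pos indep_h unfolding ok_def h_def by auto
    moreover have "supp h \<subset> supp g"
    proof -
      \<comment> \<open>Otherwise the failing inequality would have left side 0 and a nonnegative
        right side.\<close>
      have "sum g I \<noteq> 0"
        using viol nonneg[OF NV] by auto
      then obtain v where "v \<in> I" "g v \<noteq> 0"
        by (meson sum.neutral)
      then have "v \<in> supp g - supp h"
        using IV IN by (auto simp: supp_def h_def)
      moreover have "supp h \<subseteq> supp g"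
        by (auto simp: supp_def h_def)
      ultimately show ?thesis by blast
    qed
    then have "card (supp h) < card (supp g)"
      using assms(1) by (intro psubset_card_mono) (auto simp: supp_def)
    ultimately show False
      using min by fastforce
  qed
  then show ?thesis
    using that g unfolding ok_def by blast
qed

section \<open>Tensor products\<close>

text \<open>The vertices \<open>(x, y)\<close> are encoded as natural numbers, so that products can be iterated.\<close>

definition tensor_verts :: "nat set \<Rightarrow> nat set \<Rightarrow> nat set" where
  "tensor_verts V W = prod_encode ` (V \<times> W)"

definition tensor_edges :: "nat set set \<Rightarrow> nat set set \<Rightarrow> nat set set" where
  "tensor_edges E D =
     {{prod_encode (x, y), prod_encode (x', y')} | x y x' y'. {x, x'} \<in> E \<and> {y, y'} \<in> D}"

lemma tensor_edge_iff:
  "{prod_encode (x, y), prod_encode (x', y')} \<in> tensor_edges E D \<longleftrightarrow> {x, x'} \<in> E \<and> {y, y'} \<in> D"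
  unfolding tensor_edges_def by (auto simp: doubleton_eq_iff insert_commute)

lemma simple_graph_tensor:
  assumes "simple_graph V E" "simple_graph W D"
  shows "simple_graph (tensor_verts V W) (tensor_edges E D)"
  unfolding simple_graph_def
proof
  show "finite (tensor_verts V W)"
    using assms by (simp add: tensor_verts_def simple_graph_finite)
  show "tensor_edges E D \<subseteq> [tensor_verts V W]\<^bsup>2\<^esup>"
    using simple_graph_edge[OF assms(1)] simple_graph_edge[OF assms(2)]
    by (auto simp: tensor_edges_def tensor_verts_def)
qed

lemma maps_to_tensor_left: "maps_to (tensor_verts V W) (tensor_edges E D) V E"
  unfolding maps_to_def graph_hom_def
  by (intro exI[of _ "fst \<circ> prod_decode"]) (auto simp: tensor_verts_def tensor_edge_iff)

lemma maps_to_tensor_right: "maps_to (tensor_verts V W) (tensor_edges E D) W D"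
  unfolding maps_to_def graph_hom_def
  by (intro exI[of _ "snd \<circ> prod_decode"]) (auto simp: tensor_verts_def tensor_edge_iff)

lemma maps_to_tensor:
  assumes "maps_to X F V E" "maps_to X F W D"
  shows "maps_to X F (tensor_verts V W) (tensor_edges E D)"
proof -
  obtain \<phi> \<psi> where "graph_hom X F V E \<phi>" "graph_hom X F W D \<psi>"
    using assms unfolding maps_to_def by blast
  then have "graph_hom X F (tensor_verts V W) (tensor_edges E D) (\<lambda>x. prod_encode (\<phi> x, \<psi> x))"
    unfolding graph_hom_def by (auto simp: tensor_verts_def tensor_edge_iff)
  then show ?thesis unfolding maps_to_def by blast
qed

text \<open>
  An independent set \<open>U\<close> of the product splits into the vertices isolated in their fibre over the
  first factor and the rest, \<open>A\<close> and \<open>B\<close>. The fibres of \<open>A\<close> over the first factor and those of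
  \<open>B\<close> over the second factor are independent, and the unions of their closed neighbourhoods,
  taken fibrewise, are disjoint.
\<close>

lemma tensor_weight_bound:
  fixes \<kappa> :: real
  assumes V: "finite V" "\<And>v. v \<in> V \<Longrightarrow> 0 \<le> g v"
      "\<And>I. independent_set V E I \<Longrightarrow> \<kappa> * sum g I \<le> sum g (closed_nbhd V E I)"
    and W: "finite W" "\<And>w. w \<in> W \<Longrightarrow> 0 \<le> h w"
      "\<And>I. independent_set W D I \<Longrightarrow> \<kappa> * sum h I \<le> sum h (closed_nbhd W D I)"
    and U: "U \<subseteq> V \<times> W"
      "\<And>x y x' y'. (x, y) \<in> U \<Longrightarrow> (x', y') \<in> U \<Longrightarrow> {x, x'} \<in> E \<Longrightarrow> {y, y'} \<notin> D"
  shows "\<kappa> * (\<Sum>(x, y)\<in>U. g x * h y) \<le> sum g V * sum h W"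
proof -
  define A where "A x = {y. (x, y) \<in> U \<and> \<not> (\<exists>y'. (x, y') \<in> U \<and> {y, y'} \<in> D)}" for x
  define B where "B y = {x. (x, y) \<in> U \<and> (\<exists>y'. (x, y') \<in> U \<and> {y, y'} \<in> D)}" for y
  define NA where "NA x = closed_nbhd W D (A x)" for x
  define NB where "NB y = closed_nbhd V E (B y)" for y
  have subA: "A x \<subseteq> W" and subB: "B y \<subseteq> V" for x y
    using U(1) by (auto simp: A_def B_def)
  have indA: "independent_set W D (A x)" for x
    using subA unfolding independent_set_def by (auto simp: A_def)
  \<comment> \<open>If \<open>x\<close> and \<open>x'\<close> in \<open>B y\<close> were adjacent,
    choose \<open>y'\<close> adjacent to \<open>y\<close> with \<open>(x, y')\<close> in
    \<open>U\<close>; then \<open>(x, y')\<close> and \<open>(x', y)\<close> would be adjacent in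
    the product.\<close>
  have indB: "independent_set V E (B y)" for y
    using subB U(2) unfolding independent_set_def by (fastforce simp: B_def insert_commute)
  have subNA: "NA x \<subseteq> W" and subNB: "NB y \<subseteq> V" for x y
    using subA subB by (auto simp: NA_def NB_def closed_nbhd_def)
  have fin: "finite (A x)" "finite (NA x)" "finite (B y)" "finite (NB y)" for x y
    using subA subB subNA subNB V(1) W(1) by (meson finite_subset)+
  let ?w = "\<lambda>(x, y). g x * h y"
  have swap: "(\<Sum>y\<in>W. \<Sum>x\<in>S y. g x * h y) = sum ?w {(x, y). y \<in> W \<and> x \<in> S y}"
    if "\<And>y. finite (S y)" for S
  proof -
    have "(\<Sum>y\<in>W. \<Sum>x\<in>S y. g x * h y) = (\<Sum>(y, x)\<in>Sigma W S. g x * h y)"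
      using that W(1) by (simp add: sum.Sigma)
    also have "\<dots> = sum ?w {(x, y). y \<in> W \<and> x \<in> S y}"
      by (rule sum.reindex_bij_witness[of _ prod.swap prod.swap]) auto
    finally show ?thesis .
  qed
  have U_eq: "U = Sigma V A \<union> {(x, y). y \<in> W \<and> x \<in> B y}"
    using U(1) unfolding A_def B_def by blast
  moreover have "Sigma V A \<inter> {(x, y). y \<in> W \<and> x \<in> B y} = {}"
    unfolding A_def B_def by blast
  moreover have "finite (Sigma V A \<union> {(x, y). y \<in> W \<and> x \<in> B y})"
    unfolding U_eq[symmetric] using U(1) V(1) W(1) by (meson finite_SigmaI finite_subset)
  ultimately have "sum ?w U = sum ?w (Sigma V A) + sum ?w {(x, y). y \<in> W \<and> x \<in> B y}"
    by (simp add: sum.union_disjoint)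
  also have "\<dots> = (\<Sum>x\<in>V. g x * sum h (A x)) + (\<Sum>y\<in>W. h y * sum g (B y))"
    using V(1) fin swap[of B]
    by (simp add: sum.Sigma[symmetric] sum_distrib_left mult.commute)
  finally have "\<kappa> * sum ?w U
      = (\<Sum>x\<in>V. g x * (\<kappa> * sum h (A x))) + (\<Sum>y\<in>W. h y * (\<kappa> * sum g (B y)))"
    by (simp add: algebra_simps sum_distrib_left)
  also have "\<dots> \<le> (\<Sum>x\<in>V. g x * sum h (NA x)) + (\<Sum>y\<in>W. h y * sum g (NB y))"
    unfolding NA_def NB_def using V W indA indB
    by (intro add_mono sum_mono mult_left_mono) auto
  also have "\<dots> = sum ?w (Sigma V NA) + sum ?w {(x, y). y \<in> W \<and> x \<in> NB y}"
    using V(1) fin swap[of NB]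
    by (simp add: sum.Sigma[symmetric] sum_distrib_left mult.commute)
  also have "\<dots> = sum ?w (Sigma V NA \<union> {(x, y). y \<in> W \<and> x \<in> NB y})"
  proof (rule sum.union_disjoint[symmetric])
    show "finite (Sigma V NA)"
      using V(1) fin by blast
    show "finite {(x, y). y \<in> W \<and> x \<in> NB y}"
      by (rule finite_subset[of _ "V \<times> W"]) (use subNB V(1) W(1) in auto)
    show "Sigma V NA \<inter> {(x, y). y \<in> W \<and> x \<in> NB y} = {}"
    proof (rule ccontr)
      assume "Sigma V NA \<inter> {(x, y). y \<in> W \<and> x \<in> NB y} \<noteq> {}"
      then obtain x y where y: "y \<in> NA x" and x: "x \<in> NB y" by auto
      obtain a where a: "a \<in> A x" "a = y \<or> {a, y} \<in> D"
        using y by (auto simp: NA_def closed_nbhd_def)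
      obtain b where b: "b \<in> B y" "b = x \<or> {b, x} \<in> E"
        using x by (auto simp: NB_def closed_nbhd_def)
      obtain y' where y': "(b, y') \<in> U" "{y, y'} \<in> D" and bU: "(b, y) \<in> U"
        using b(1) by (auto simp: B_def)
      have aU: "(x, a) \<in> U" and iso: "\<And>z. (x, z) \<in> U \<Longrightarrow> {a, z} \<notin> D"
        using a(1) by (auto simp: A_def)
      \<comment> \<open>If \<open>b = x\<close>, then \<open>a\<close> is not isolated in its fibre,
        because of \<open>y'\<close> or \<open>y\<close>. If \<open>b\<close> is adjacent to
        \<open>x\<close>, then \<open>(x, a)\<close> is adjacent in the product to
        \<open>(b, y')\<close> or to \<open>(b, y)\<close>.\<close>
      consider "a = y" "b = x" | "a = y" "{b, x} \<in> E" | "{a, y} \<in> D" "b = x" | "{a, y} \<in> D" "{b, x} \<in> E"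
        using a(2) b(2) by blast
      then show False
      proof cases
        case 1
        then show ?thesis using iso y' by blast
      next
        case 2
        then show ?thesis using U(2)[OF y'(1) aU] y'(2) by (simp add: insert_commute)
      next
        case 3
        then show ?thesis using iso bU by blast
      next
        case 4
        then show ?thesis using U(2)[OF bU aU] by (simp add: insert_commute)
      qed
    qed
  qed
  also have "\<dots> \<le> sum ?w (V \<times> W)"
    using subNA subNB V W by (intro sum_mono2) (auto intro!: mult_nonneg_nonneg)
  also have "\<dots> = sum g V * sum h W"
    by (simp add: sum_product sum.cartesian_product)
  finally show ?thesis .
qed

text \<open>The witness is the product of the weights from
  \<open>fractional_clique_neighbourhood\<close>, whose stronger inequality
  \<open>tensor_weight_bound\<close> requires. This is the hard half of the fractional Hedetniemi
  theorem.\<close>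

lemma fractional_chromatic_ge_tensor:
  assumes "finite V" "finite W" "fractional_chromatic_ge \<kappa> V E" "fractional_chromatic_ge \<kappa> W D"
  shows "fractional_chromatic_ge \<kappa> (tensor_verts V W) (tensor_edges E D)"
proof -
  obtain g where g: "\<And>v. v \<in> V \<Longrightarrow> 0 \<le> g v" "0 < sum g V"
    "\<And>I. independent_set V E I \<Longrightarrow> \<kappa> * sum g I \<le> sum g (closed_nbhd V E I)"
    using fractional_clique_neighbourhood[OF assms(1,3)] by blast
  obtain h where h: "\<And>w. w \<in> W \<Longrightarrow> 0 \<le> h w" "0 < sum h W"
    "\<And>I. independent_set W D I \<Longrightarrow> \<kappa> * sum h I \<le> sum h (closed_nbhd W D I)"
    using fractional_clique_neighbourhood[OF assms(2,4)] by blast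
  define w where "w = (\<lambda>(x, y). g x * h y) \<circ> prod_decode"
  have sum_w: "sum w (prod_encode ` U) = (\<Sum>(x, y)\<in>U. g x * h y)" for U
    by (simp add: w_def sum.reindex inj_prod_encode o_def)
  have total: "sum w (tensor_verts V W) = sum g V * sum h W"
    unfolding tensor_verts_def sum_w by (simp add: sum_product sum.cartesian_product)
  show ?thesis
    unfolding fractional_chromatic_ge_def
  proof (intro exI[of _ w] conjI ballI allI impI)
    fix I assume I: "independent_set (tensor_verts V W) (tensor_edges E D) I"
    then obtain U where U: "U \<subseteq> V \<times> W" "I = prod_encode ` U"
      unfolding independent_set_def tensor_verts_def by (meson subset_image_iff)
    have "{y, y'} \<notin> D" if "(x, y) \<in> U" "(x', y') \<in> U" "{x, x'} \<in> E" for x y x' y'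
      using I that U(2) unfolding independent_set_def by (metis imageI tensor_edge_iff)
    then show "\<kappa> * sum w I \<le> sum w (tensor_verts V W)"
      unfolding total U(2) sum_w
      using tensor_weight_bound[OF assms(1) g(1,3) assms(2) h(1,3) U(1)] by blast
  next
    show "0 < sum w (tensor_verts V W)"
      using g(2) h(2) by (simp add: total)
  qed (use g h in \<open>auto simp: w_def tensor_verts_def\<close>)
qed

section \<open>Clique covers and iterated products\<close>

definition clique_covered :: "nat \<Rightarrow> 'a set \<Rightarrow> 'a set set \<Rightarrow> bool" where
  "clique_covered s V E \<longleftrightarrow> (\<forall>v\<in>V. \<exists>K\<subseteq>V. v \<in> K \<and> finite K \<and> card K = s \<and> [K]\<^bsup>2\<^esup> \<subseteq> E)"

text \<open>Take \<open>s\<close>-cliques \<open>K\<close> at \<open>x\<close> and \<open>L\<close>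
  at \<open>y\<close>. The graph of a bijection from \<open>K\<close> to \<open>L\<close> sending
  \<open>x\<close> to \<open>y\<close> is an \<open>s\<close>-clique of the product through
  \<open>(x, y)\<close>.\<close>

lemma clique_covered_tensor:
  assumes "clique_covered s V E" "clique_covered s W D"
  shows "clique_covered s (tensor_verts V W) (tensor_edges E D)"
  unfolding clique_covered_def
proof
  fix v assume "v \<in> tensor_verts V W"
  then obtain x y where xy: "x \<in> V" "y \<in> W" "v = prod_encode (x, y)"
    by (auto simp: tensor_verts_def)
  obtain K where K: "K \<subseteq> V" "x \<in> K" "finite K" "card K = s" "[K]\<^bsup>2\<^esup> \<subseteq> E"
    using assms(1) xy unfolding clique_covered_def by blast
  obtain L where L: "L \<subseteq> W" "y \<in> L" "finite L" "card L = s" "[L]\<^bsup>2\<^esup> \<subseteq> D"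
    using assms(2) xy unfolding clique_covered_def by blast
  have "card (K - {x}) = card (L - {y})"
    using K L by simp
  then obtain \<sigma> where \<sigma>: "bij_betw \<sigma> (K - {x}) (L - {y})"
    using finite_same_card_bij[of "K - {x}" "L - {y}"] K(3) L(3) by auto
  define \<tau> where "\<tau> = \<sigma>(x := y)"
  have "bij_betw \<tau> (K - {x}) (L - {y})"
    using \<sigma> bij_betw_cong[of "K - {x}" \<sigma> \<tau> "L - {y}"] by (simp add: \<tau>_def)
  then have "bij_betw \<tau> (insert x (K - {x})) (insert y (L - {y}))"
    using bij_betw_combine[of \<tau> "K - {x}" "L - {y}" "{x}" "{y}"]
    by (simp add: \<tau>_def bij_betw_def)
  then have "bij_betw \<tau> K L"
    using K(2) L(2) by (simp add: insert_absorb)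
  then have \<tau>: "\<tau> x = y" "inj_on \<tau> K" "\<tau> ` K \<subseteq> L"
    by (simp_all add: \<tau>_def bij_betw_def)
  define c where "c a = prod_encode (a, \<tau> a)" for a
  have inj: "inj_on c K"
    by (auto simp: c_def inj_on_def)
  show "\<exists>Q\<subseteq>tensor_verts V W. v \<in> Q \<and> finite Q \<and> card Q = s \<and> [Q]\<^bsup>2\<^esup> \<subseteq> tensor_edges E D"
  proof (intro exI[of _ "c ` K"] conjI)
    show "c ` K \<subseteq> tensor_verts V W"
      unfolding c_def tensor_verts_def using K(1) L(1) \<tau>(3)
      by (intro image_subsetI imageI) auto
    show "v \<in> c ` K"
      using K(2) \<tau>(1) xy(3) by (auto simp: c_def)
    show "finite (c ` K)" "card (c ` K) = s"
      using K(3,4) inj by (auto simp: card_image)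
    show "[c ` K]\<^bsup>2\<^esup> \<subseteq> tensor_edges E D"
    proof
      fix e assume "e \<in> [c ` K]\<^bsup>2\<^esup>"
      then obtain a b where ab: "e = {c a, c b}" "a \<in> K" "b \<in> K" "a \<noteq> b"
        by (auto elim!: nsets2_E)
      then have "{a, b} \<in> E" "{\<tau> a, \<tau> b} \<in> D"
        using \<tau>(2,3) by (intro subsetD[OF K(5)] subsetD[OF L(5)]; simp add: image_subset_iff inj_on_eq_iff)+
      then show "e \<in> tensor_edges E D"
        using ab(1) by (simp add: c_def tensor_edge_iff)
    qed
  qed
qed

text \<open>The product of all members of \<F> projects to each of them, and \<Phi> collects the
  properties that survive taking products.\<close>

lemma finite_product_of_graphs:
  assumes "finite \<F>" "\<F> \<noteq> {}" "\<And>V E. (V, E) \<in> \<F> \<Longrightarrow> \<Phi> V E"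
    and closed: "\<And>V E W D. \<Phi> V E \<Longrightarrow> \<Phi> W D \<Longrightarrow> \<Phi> (tensor_verts V W) (tensor_edges E D)"
  obtains V E where "\<Phi> V E" "\<And>W D. (W, D) \<in> \<F> \<Longrightarrow> maps_to V E W D"
proof -
  have "\<exists>V E. \<Phi> V E \<and> (\<forall>(W, D)\<in>\<F>. maps_to V E W D)"
    using assms(1-3)
  proof (induction rule: finite_ne_induct)
    case (singleton G)
    obtain W D where "G = (W, D)" by fastforce
    moreover have "maps_to W D W D"
      by (simp add: maps_to_subgraph)
    ultimately show ?case
      using singleton by auto
  next
    case (insert G \<F>)
    obtain W D where G: "G = (W, D)" by fastforce
    obtain V E where VE: "\<Phi> V E" "\<And>X F. (X, F) \<in> \<F> \<Longrightarrow> maps_to V E X F"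
      using insert by fastforce
    have "\<Phi> (tensor_verts V W) (tensor_edges E D)"
      using closed[OF VE(1), of W D] insert.prems[of W D] G by simp
    moreover have "maps_to (tensor_verts V W) (tensor_edges E D) X F" if "(X, F) \<in> insert G \<F>" for X F
      using that VE(2)[THEN maps_to_trans[OF maps_to_tensor_left]] G maps_to_tensor_right
      by (cases "(X, F) = G") auto
    ultimately have "\<Phi> (tensor_verts V W) (tensor_edges E D) \<and>
        (\<forall>(X, F)\<in>insert G \<F>. maps_to (tensor_verts V W) (tensor_edges E D) X F)"
      by blast
    then show ?case by (intro exI)
  qed
  then obtain V E where "\<Phi> V E" "\<forall>(W, D)\<in>\<F>. maps_to V E W D"
    by blast
  then show ?thesis using that[of V E] by blast
qed

section \<open>Monochromatic homomorphic images\<close>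

definition colour_class :: "('a set \<Rightarrow> nat) \<Rightarrow> 'a set \<Rightarrow> nat \<Rightarrow> 'a set set" where
  "colour_class f W i = {e \<in> [W]\<^bsup>2\<^esup>. f e = i}"

text \<open>A family is allowed in order to treat a clique and a second graph as alternatives, of
  which a colouring need contain only one.\<close>

definition unavoidable :: "'b set \<Rightarrow> ('a set \<times> 'a set set) set \<Rightarrow> bool" where
  "unavoidable W \<G> \<longleftrightarrow>
     (\<forall>f \<in> [W]\<^bsup>2\<^esup> \<rightarrow> {..<2::nat}. \<exists>i<2. \<exists>(V, E)\<in>\<G>. maps_to V E W (colour_class f W i))"

abbreviation complete_graph :: "nat \<Rightarrow> nat set \<times> nat set set" where
  "complete_graph s \<equiv> ({..<s}, [{..<s}]\<^bsup>2\<^esup>)"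

lemma colour_class_edge [simp]:
  "{u, v} \<in> colour_class f W i \<longleftrightarrow> u \<in> W \<and> v \<in> W \<and> u \<noteq> v \<and> f {u, v} = i"
  by (auto simp: colour_class_def)

lemma colour_class_subset: "colour_class f W i \<subseteq> [W]\<^bsup>2\<^esup>"
  by (auto simp: colour_class_def)

lemma colour_class_mono: "W \<subseteq> W' \<Longrightarrow> colour_class f W i \<subseteq> colour_class f W' i"
  using nsets_mono by (fastforce simp: colour_class_def)

lemma simple_graph_colour_class: "finite W \<Longrightarrow> simple_graph W (colour_class f W i)"
  by (simp add: simple_graph_def colour_class_subset)

lemma clique_edges_mono: "K \<subseteq> W \<Longrightarrow> [K]\<^bsup>2\<^esup> \<subseteq> colour_class f W' i \<Longrightarrow> [K]\<^bsup>2\<^esup> \<subseteq> colour_class f W i"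
  using nsets_mono[of K W 2] by (auto simp: colour_class_def)

lemma unavoidable_inj:
  assumes "unavoidable W \<G>" "inj_on \<phi> W" "\<phi> \<in> W \<rightarrow> W'"
  shows "unavoidable W' \<G>"
  unfolding unavoidable_def
proof
  fix f assume f: "f \<in> [W']\<^bsup>2\<^esup> \<rightarrow> {..<2::nat}"
  let ?g = "f \<circ> (`) \<phi>"
  have "?g \<in> [W]\<^bsup>2\<^esup> \<rightarrow> {..<2}"
    using nsets_compose_image_funcset[OF f assms(3,2)] .
  then obtain i V E where i: "i < 2" "(V, E) \<in> \<G>" "maps_to V E W (colour_class ?g W i)"
    using assms(1) unfolding unavoidable_def by fast
  have "graph_hom W (colour_class ?g W i) W' (colour_class f W' i) \<phi>"
    using assms(2,3) unfolding graph_hom_def by (auto simp: inj_on_eq_iff)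
  then have "maps_to V E W' (colour_class f W' i)"
    using i(3) maps_to_trans unfolding maps_to_def by blast
  then show "\<exists>i<2. \<exists>(V, E)\<in>\<G>. maps_to V E W' (colour_class f W' i)"
    using i by blast
qed

lemma unavoidable_mono: "unavoidable {..<m} \<G> \<Longrightarrow> m \<le> n \<Longrightarrow> unavoidable {..<n::nat} \<G>"
  by (rule unavoidable_inj[of _ _ id]) auto

text \<open>Since \<open>D\<close> has no loops, adjacent images are distinct, so \<phi> is
  injective on \<open>A\<close>.\<close>

lemma clique_of_pairwise_adjacent:
  assumes "finite A" "D \<subseteq> [W]\<^bsup>2\<^esup>" "\<phi> \<in> A \<rightarrow> W"
    and "\<And>a b. a \<in> A \<Longrightarrow> b \<in> A \<Longrightarrow> a \<noteq> b \<Longrightarrow> {\<phi> a, \<phi> b} \<in> D"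
  shows "\<phi> ` A \<subseteq> W" "finite (\<phi> ` A)" "card (\<phi> ` A) = card A" "[\<phi> ` A]\<^bsup>2\<^esup> \<subseteq> D"
proof -
  have "\<phi> a \<noteq> \<phi> b" if "a \<in> A" "b \<in> A" "a \<noteq> b" for a b
    using subsetD[OF assms(2) assms(4)[OF that]] by simp
  then show "card (\<phi> ` A) = card A"
    by (intro card_image) (auto simp: inj_on_def)
  show "[\<phi> ` A]\<^bsup>2\<^esup> \<subseteq> D"
  proof
    fix e assume "e \<in> [\<phi> ` A]\<^bsup>2\<^esup>"
    then obtain x y where xy: "e = {x, y}" "x \<in> \<phi> ` A" "y \<in> \<phi> ` A" "x \<noteq> y"
      by (rule nsets2_E)
    then obtain a b where "x = \<phi> a" "y = \<phi> b" "a \<in> A" "b \<in> A" by blast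
    then show "e \<in> D"
      using assms(4)[of a b] xy(1,4) by blast
  qed
qed (use assms in auto)

lemma maps_to_complete_graph_iff:
  assumes "D \<subseteq> [W]\<^bsup>2\<^esup>"
  shows "maps_to {..<s} ([{..<s::nat}]\<^bsup>2\<^esup>) W D
    \<longleftrightarrow> (\<exists>K\<subseteq>W. finite K \<and> card K = s \<and> [K]\<^bsup>2\<^esup> \<subseteq> D)"
proof
  assume "maps_to {..<s} ([{..<s::nat}]\<^bsup>2\<^esup>) W D"
  then obtain \<phi> where \<phi>: "graph_hom {..<s} ([{..<s}]\<^bsup>2\<^esup>) W D \<phi>"
    unfolding maps_to_def by blast
  show "\<exists>K\<subseteq>W. finite K \<and> card K = s \<and> [K]\<^bsup>2\<^esup> \<subseteq> D"
    using clique_of_pairwise_adjacent[of "{..<s}" D W \<phi>] \<phi> assms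
    unfolding graph_hom_def by (intro exI[of _ "\<phi> ` {..<s}"]) auto
next
  assume "\<exists>K\<subseteq>W. finite K \<and> card K = s \<and> [K]\<^bsup>2\<^esup> \<subseteq> D"
  then obtain K where K: "K \<subseteq> W" "finite K" "card K = s" "[K]\<^bsup>2\<^esup> \<subseteq> D" by blast
  then obtain \<phi> where "bij_betw \<phi> {..<s} K"
    using ex_bij_betw_nat_finite lessThan_atLeast0 by metis
  then have "graph_hom {..<s} ([{..<s}]\<^bsup>2\<^esup>) W D \<phi>"
    using K(1) unfolding graph_hom_def bij_betw_def
    by (auto simp: inj_on_eq_iff intro!: subsetD[OF K(4)])
  then show "maps_to {..<s} ([{..<s::nat}]\<^bsup>2\<^esup>) W D"
    unfolding maps_to_def by blast
qed

lemma partn_iff_unavoidable: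
  "partn W k 2 {..<2::nat} \<longleftrightarrow> unavoidable W {complete_graph k}"
proof -
  have "monochromatic W k 2 f i
      \<longleftrightarrow> maps_to {..<k} ([{..<k::nat}]\<^bsup>2\<^esup>) W (colour_class f W i)" for f :: "'a set \<Rightarrow> nat" and i
  proof -
    have "f ` [H]\<^bsup>2\<^esup> \<subseteq> {i} \<longleftrightarrow> [H]\<^bsup>2\<^esup> \<subseteq> colour_class f W i" if "H \<subseteq> W" for H
      using nsets_mono[OF that, of 2] by (auto simp: colour_class_def)
    then show ?thesis
      unfolding monochromatic_def maps_to_complete_graph_iff[OF colour_class_subset]
      by (auto simp: nsets_def)
  qed
  then show ?thesis
    unfolding partn_def unavoidable_def by (simp only: Bex_def lessThan_iff) simp
qed

text \<open>For \<open>i < 2\<close> the natural number \<open>1 - i\<close> is the other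
  colour.\<close>

lemma independent_set_colour_class:
  assumes "f \<in> [W]\<^bsup>2\<^esup> \<rightarrow> {..<2::nat}" "i < 2" "independent_set W (colour_class f W i) I"
  shows "I \<subseteq> W" "[I]\<^bsup>2\<^esup> \<subseteq> colour_class f W (1 - i)"
proof -
  show sub: "I \<subseteq> W"
    using assms(3) by (simp add: independent_set_def)
  show "[I]\<^bsup>2\<^esup> \<subseteq> colour_class f W (1 - i)"
  proof
    fix e assume e: "e \<in> [I]\<^bsup>2\<^esup>"
    then have eW: "e \<in> [W]\<^bsup>2\<^esup>"
      using nsets_mono[OF sub] by blast
    obtain u v where uv: "e = {u, v}" "u \<in> I" "v \<in> I"
      using e by (auto elim!: nsets2_E)
    then have "f e \<noteq> i"
      using assms(3) eW unfolding independent_set_def colour_class_def by blast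
    moreover have "f e < 2"
      using assms(1) eW by auto
    ultimately show "e \<in> colour_class f W (1 - i)"
      using eW assms(2) unfolding colour_class_def by auto
  qed
qed

text \<open>
  A homomorphism from the product amounts to \<open>s + 1\<close> points \<open>f x i\<close> for every vertex \<open>x\<close>. Because
  \<open>x\<close> lies in an \<open>s\<close>-clique, these points are independent, so two of them coincide; a repeated
  value for every \<open>x\<close> defines a homomorphism from the second factor.
\<close>

lemma maps_to_of_tensor_complete:
  assumes W: "finite W" "D \<subseteq> [W]\<^bsup>2\<^esup>"
    and no_clique: "\<And>K. K \<subseteq> W \<Longrightarrow> card K = Suc s \<Longrightarrow> \<not> [K]\<^bsup>2\<^esup> \<subseteq> D"
    and no_indep: "\<And>I. independent_set W D I \<Longrightarrow> card I \<noteq> Suc s"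
    and cov: "clique_covered s V E"
    and hom: "maps_to (tensor_verts {..<Suc s} V) (tensor_edges ([{..<Suc s}]\<^bsup>2\<^esup>) E) W D"
  shows "maps_to V E W D"
proof -
  obtain h where h: "graph_hom (tensor_verts {..<Suc s} V) (tensor_edges ([{..<Suc s}]\<^bsup>2\<^esup>) E) W D h"
    using hom unfolding maps_to_def by blast
  define f where "f x i = h (prod_encode (i, x))" for x i
  have fW: "f x i \<in> W" if "x \<in> V" "i < Suc s" for x i
    using h that unfolding graph_hom_def f_def tensor_verts_def by (auto simp: Pi_iff)
  have adj: "{f x i, f y j} \<in> D"
    if "x \<in> V" "y \<in> V" "{x, y} \<in> E" "i < Suc s" "j < Suc s" "i \<noteq> j" for x y i j
  proof -
    have "prod_encode (i, x) \<in> tensor_verts {..<Suc s} V" "prod_encode (j, y) \<in> tensor_verts {..<Suc s} V"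
      "{prod_encode (i, x), prod_encode (j, y)} \<in> tensor_edges ([{..<Suc s}]\<^bsup>2\<^esup>) E"
      using that by (auto simp: tensor_verts_def tensor_edge_iff)
    then show ?thesis
      using h unfolding graph_hom_def f_def by blast
  qed
  have indep: "{f x i, f x j} \<notin> D" if x: "x \<in> V" and ij: "i < Suc s" "j < Suc s" "i \<noteq> j" for x i j
  proof
    assume edge: "{f x i, f x j} \<in> D"
    obtain K where K: "K \<subseteq> V" "x \<in> K" "finite K" "card K = s" "[K]\<^bsup>2\<^esup> \<subseteq> E"
      using cov x unfolding clique_covered_def by blast
    have "card ({..<Suc s} - {i, j}) = card (K - {x})"
      using K ij by (simp add: card_Diff_subset)
    then obtain \<gamma> where \<gamma>: "bij_betw \<gamma> ({..<Suc s} - {i, j}) (K - {x})"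
      using finite_same_card_bij[of "{..<Suc s} - {i, j}" "K - {x}"] K(3) by auto
    \<comment> \<open>The points \<open>f (\<tau> l) l\<close> will form a clique of size
      \<open>Suc s\<close>: different values of \<tau> are adjacent in \<open>K\<close>, and for the
      only coincidence, \<open>\<tau> i = \<tau> j = x\<close>, the assumed edge steps in.\<close>
    define \<tau> where "\<tau> l = (if l \<in> {i, j} then x else \<gamma> l)" for l
    have \<gamma>_ne: "\<gamma> l \<in> K \<and> \<gamma> l \<noteq> x" if "l < Suc s" "l \<notin> {i, j}" for l
      using bij_betwE[OF \<gamma>] that by blast
    have \<gamma>_inj: "inj_on \<gamma> ({..<Suc s} - {i, j})"
      using \<gamma> by (simp add: bij_betw_def)
    have \<tau>K: "\<tau> l \<in> K" if "l < Suc s" for l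
      using \<gamma>_ne K(2) that by (simp add: \<tau>_def)
    have \<tau>_eq: "{l, m} = {i, j}" if lm: "l < Suc s" "m < Suc s" "l \<noteq> m" "\<tau> l = \<tau> m" for l m
    proof -
      have "l \<in> {i, j} \<and> m \<in> {i, j}"
      proof (rule ccontr)
        assume "\<not> (l \<in> {i, j} \<and> m \<in> {i, j})"
        then consider "l \<notin> {i, j}" "m \<in> {i, j}" | "l \<in> {i, j}" "m \<notin> {i, j}"
          | "l \<notin> {i, j}" "m \<notin> {i, j}"
          by blast
        then show False
        proof cases
          case 1
          then show ?thesis using lm \<gamma>_ne[of l] by (simp add: \<tau>_def)
        next
          case 2
          then show ?thesis using lm \<gamma>_ne[of m] by (simp add: \<tau>_def)
        next
          case 3
          then show ?thesis using lm inj_onD[OF \<gamma>_inj, of l m] by (simp add: \<tau>_def)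
        qed
      qed
      then show ?thesis using lm(3) by blast
    qed
    have "{f (\<tau> l) l, f (\<tau> m) m} \<in> D" if lm: "l < Suc s" "m < Suc s" "l \<noteq> m" for l m
    proof (cases "\<tau> l = \<tau> m")
      case True
      then have "{l, m} = {i, j}" using \<tau>_eq lm by blast
      then show ?thesis
        using edge by (auto simp: \<tau>_def doubleton_eq_iff insert_commute)
    next
      case False
      then have "{\<tau> l, \<tau> m} \<in> E"
        using \<tau>K lm by (intro subsetD[OF K(5)]) simp
      then show ?thesis
        using adj \<tau>K K(1) lm by blast
    qed
    moreover have "(\<lambda>l. f (\<tau> l) l) \<in> {..<Suc s} \<rightarrow> W"
      using fW \<tau>K K(1) by blast
    ultimately show False
      using clique_of_pairwise_adjacent[of "{..<Suc s}" D W "\<lambda>l. f (\<tau> l) l"] W(2)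
        no_clique[of "(\<lambda>l. f (\<tau> l) l) ` {..<Suc s}"] by simp
  qed
  have "\<exists>i j. i < Suc s \<and> j < Suc s \<and> i \<noteq> j \<and> f x i = f x j" if x: "x \<in> V" for x
  proof (rule ccontr)
    assume "\<not> ?thesis"
    then have "inj_on (f x) {..<Suc s}" by (auto simp: inj_on_def)
    then have card: "card (f x ` {..<Suc s}) = Suc s" by (simp add: card_image)
    have "{u, u} \<notin> D" for u
      using subsetD[OF W(2), of "{u, u}"] doubleton_in_nsets_2[of u u W] by blast
    then have "independent_set W D (f x ` {..<Suc s})"
      using indep[OF x] fW[OF x] unfolding independent_set_def by fastforce
    then show False using no_indep card by blast
  qed
  then obtain i j where ij: "\<And>x. x \<in> V \<Longrightarrow> i x < Suc s \<and> j x < Suc s \<and> i x \<noteq> j x \<and> f x (i x) = f x (j x)"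
    by metis
  \<comment> \<open>Adjacency in the product requires different indices; if
    \<open>i x = i y\<close>, the index \<open>j x\<close>, which gives the same point, replaces
    \<open>i x\<close>.\<close>
  have "{f x (i x), f y (i y)} \<in> D" if "x \<in> V" "y \<in> V" "{x, y} \<in> E" for x y
  proof (cases "i x = i y")
    case True
    then have "{f x (j x), f y (i y)} \<in> D"
      using adj[OF that] ij that by metis
    then show ?thesis using ij that by simp
  qed (use adj[OF that] ij that in blast)
  then have "graph_hom V E W D (\<lambda>x. f x (i x))"
    using ij fW unfolding graph_hom_def by blast
  then show ?thesis unfolding maps_to_def by blast
qed

section \<open>Graphs with prescribed Ramsey number\<close>

text \<open>Let \<open>r\<close> be the chromatic number of the given graph. It maps neither to the
  part of \<open>S\<close> outside all \<open>s\<close>-cliques nor to a largest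
  \<open>(r - 1)\<close>-colourable set \<open>W\<close>, so each has at most a fifth of the points.
  The uniform weight on the remaining points shows the bound \<open>r + 1\<close>.\<close>

lemma large_fractional_subgraph:
  fixes S :: "'a set" and V :: "'b set"
  assumes S: "finite S" "S \<noteq> {}"
    and P: "simple_graph V E" "V \<noteq> {}" "clique_covered s V E" "chromatic_number V E \<ge> 2"
    and sparse: "\<And>T. T \<subseteq> S \<Longrightarrow> \<not> maps_to V E T (colour_class f T i) \<Longrightarrow> 5 * card T \<le> card S"
  obtains S' where "S' \<subseteq> S" "clique_covered s S' (colour_class f S' i)"
    "fractional_chromatic_ge (chromatic_number V E + 1) S' (colour_class f S' i)"
proof -
  define r where "r = chromatic_number V E"
  define S' where "S' = {v \<in> S. \<exists>K\<subseteq>S. v \<in> K \<and> finite K \<and> card K = s \<and> [K]\<^bsup>2\<^esup> \<subseteq> colour_class f S i}"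
  have S'S: "S' \<subseteq> S" by (auto simp: S'_def)
  have cov: "clique_covered s S' (colour_class f S' i)"
    unfolding clique_covered_def
  proof
    fix v assume "v \<in> S'"
    then obtain K where K: "K \<subseteq> S" "v \<in> K" "finite K" "card K = s" "[K]\<^bsup>2\<^esup> \<subseteq> colour_class f S i"
      by (auto simp: S'_def)
    then have KS': "K \<subseteq> S'" by (auto simp: S'_def)
    then show "\<exists>K\<subseteq>S'. v \<in> K \<and> finite K \<and> card K = s \<and> [K]\<^bsup>2\<^esup> \<subseteq> colour_class f S' i"
      using K clique_edges_mono[OF KS' K(5)] by (intro exI[of _ K]) simp
  qed
  \<comment> \<open>A homomorphism would carry an \<open>s\<close>-clique into the part left over,
    whose points lie in no such clique.\<close>
  have rest: "5 * card (S - S') \<le> card S"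
  proof (rule sparse)
    show "\<not> maps_to V E (S - S') (colour_class f (S - S') i)"
    proof
      assume "maps_to V E (S - S') (colour_class f (S - S') i)"
      then obtain \<phi> where \<phi>: "graph_hom V E (S - S') (colour_class f (S - S') i) \<phi>"
        unfolding maps_to_def by blast
      obtain v where v: "v \<in> V" using P(2) by blast
      then obtain K where K: "K \<subseteq> V" "v \<in> K" "finite K" "card K = s" "[K]\<^bsup>2\<^esup> \<subseteq> E"
        using P(3) unfolding clique_covered_def by blast
      have "{\<phi> a, \<phi> b} \<in> colour_class f (S - S') i" if "a \<in> K" "b \<in> K" "a \<noteq> b" for a b
        using \<phi> K(1) that subsetD[OF K(5), of "{a, b}"] unfolding graph_hom_def by auto
      moreover have "\<phi> \<in> K \<rightarrow> S - S'"
        using \<phi> K(1) unfolding graph_hom_def by blast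
      ultimately have Q: "\<phi> ` K \<subseteq> S - S'" "finite (\<phi> ` K)" "card (\<phi> ` K) = s"
          "[\<phi> ` K]\<^bsup>2\<^esup> \<subseteq> colour_class f (S - S') i"
        using clique_of_pairwise_adjacent[OF K(3) colour_class_subset, of \<phi> "S - S'" f i] K(4)
        by simp_all
      have QS: "\<phi> ` K \<subseteq> S" using Q(1) by blast
      have "\<phi> v \<in> S'"
        unfolding S'_def using QS Q(2,3) K(2) clique_edges_mono[OF QS Q(4)]
        by (intro CollectI conjI exI[of _ "\<phi> ` K"]) auto
      then show False using Q(1) K(2) by blast
    qed
  qed blast
  define col where "col T c \<longleftrightarrow> T \<subseteq> S \<and>
      graph_hom T (colour_class f T i) {..<r - 1} ([{..<r - 1}]\<^bsup>2\<^esup>) c" for T and c :: "'a \<Rightarrow> nat"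
  have "col {} c" for c by (simp add: col_def graph_hom_def)
  moreover have "\<forall>T. (\<exists>c. col T c) \<longrightarrow> card T < Suc (card S)"
    using S(1) by (auto simp: col_def card_mono less_Suc_eq_le)
  ultimately have "\<exists>W. (\<exists>c. col W c) \<and> (\<forall>T. (\<exists>c. col T c) \<longrightarrow> card T \<le> card W)"
    by (intro ex_has_greatest_nat[where k = "{}" and b = "Suc (card S)"]) auto
  then obtain W c where W: "col W c" and max: "\<And>T c. col T c \<Longrightarrow> card T \<le> card W"
    by blast
  have WS: "W \<subseteq> S" and finW: "finite W"
    using W S(1) finite_subset by (auto simp: col_def)
  have "\<not> maps_to V E W (colour_class f W i)"
  proof
    assume "maps_to V E W (colour_class f W i)"
    then have "maps_to V E {..<r - 1} ([{..<r - 1}]\<^bsup>2\<^esup>)"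
      using W maps_to_trans unfolding col_def maps_to_def by blast
    then have "r \<le> r - 1"
      using chromatic_number_le_iff[OF P(1)] by (simp add: r_def)
    then show False using P(4) by (simp add: r_def)
  qed
  then have cardW: "5 * card W \<le> card S"
    using sparse WS by blast
  have indep: "(r - 1) * card I \<le> card W"
    if I: "I \<subseteq> S - W" "\<And>u v. u \<in> I \<Longrightarrow> v \<in> I \<Longrightarrow> {u, v} \<notin> colour_class f S i" for I
  proof -
    have finI: "finite I" using I(1) S(1) finite_subset by blast
    \<comment> \<open>Replacing the class of colour \<open>j\<close> by \<open>I\<close> gives
      another \<open>(r - 1)\<close>-colourable set, and \<open>W\<close> is a largest one.\<close>
    have cls: "card I \<le> card {w \<in> W. c w = j}" if j: "j < r - 1" for j
    proof -
      let ?T = "W - {w \<in> W. c w = j} \<union> I"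
      let ?c = "\<lambda>v. if v \<in> I then j else c v"
      have cW: "c u < r - 1" if "u \<in> W" for u
        using W that unfolding col_def graph_hom_def by blast
      have "?c u < r - 1 \<and> ?c v < r - 1 \<and> ?c u \<noteq> ?c v"
        if uv: "u \<in> ?T" "v \<in> ?T" "{u, v} \<in> colour_class f ?T i" for u v
      proof -
        have uv': "u \<noteq> v" "f {u, v} = i" using uv(3) by simp_all
        have "c u \<noteq> c v" if "u \<in> W" "v \<in> W"
          using W uv' that unfolding col_def graph_hom_def by simp
        moreover have "\<not> (u \<in> I \<and> v \<in> I)"
          using I(2)[of u v] I(1) uv' by auto
        ultimately show ?thesis
          using uv(1,2) cW j by auto
      qed
      then have "col ?T ?c"
        using WS I(1) cW j unfolding col_def graph_hom_def by auto
      then have "card ?T \<le> card W" by (rule max)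
      moreover have "card ?T = card W - card {w \<in> W. c w = j} + card I"
        using finW finI I(1) by (subst card_Un_disjoint) (auto simp: card_Diff_subset)
      moreover have "card {w \<in> W. c w = j} \<le> card W"
        using finW by (intro card_mono) auto
      ultimately show ?thesis by linarith
    qed
    have "(r - 1) * card I = (\<Sum>j<r - 1. card I)" by simp
    also have "\<dots> \<le> (\<Sum>j<r - 1. card {w \<in> W. c w = j})"
      using cls by (intro sum_mono) auto
    also have "\<dots> = card W"
      using W finW sum.group[of W "{..<r - 1}" c "\<lambda>_. 1::nat"] unfolding col_def graph_hom_def by auto
    finally show ?thesis .
  qed
  let ?T = "S' - W"
  have "card S \<le> card ?T + card (S - S') + card W"
  proof -
    have "S = ?T \<union> (S - S') \<union> W" using S'S WS by blast
    then have "card S = card (?T \<union> (S - S') \<union> W)" by simp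
    then show ?thesis
      using card_Un_le[of "?T \<union> (S - S')" W] card_Un_le[of ?T "S - S'"] by linarith
  qed
  then have cardT: "3 * card S \<le> 5 * card ?T"
    using rest cardW by linarith
  have "fractional_chromatic_ge (real (r + 1)) S' (colour_class f S' i)"
  proof (rule fractional_chromatic_ge_uniform)
    show "finite S'" "?T \<subseteq> S'" using S(1) S'S finite_subset by auto
    show "?T \<noteq> {}"
    proof
      assume "?T = {}"
      then have "card S = 0" using cardT by (simp only: card.empty)
      then show False using S by simp
    qed
    fix I assume I: "independent_set S' (colour_class f S' i) I"
    then have "(r - 1) * card (I \<inter> ?T) \<le> card W"
      using S'S by (intro indep) (auto simp: independent_set_def)
    \<comment> \<open>\<open>r + 1 \<le> 3 * (r - 1)\<close> since \<open>r\<close> is at least 2.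
      The factor 3 is available because \<open>?T\<close> has at least three fifths of the points of
      \<open>S\<close> and \<open>W\<close> at most one fifth.\<close>
    moreover have "(r + 1) * card (I \<inter> ?T) \<le> (3 * (r - 1)) * card (I \<inter> ?T)"
      using P(4) by (intro mult_right_mono) (auto simp: r_def)
    ultimately have "(r + 1) * card (I \<inter> ?T) \<le> card ?T"
      using cardW cardT by linarith
    then show "real (r + 1) * real (card (I \<inter> ?T)) \<le> real (card ?T)"
      by (metis of_nat_le_iff of_nat_mult)
  qed
  then show ?thesis
    using that[OF S'S cov] by (simp add: r_def)
qed


text \<open>If colour 0 fails on all \<open>N\<close> points, some \<open>S\<close> with more than
  \<open>N / 5\<close> points receives no image in colour 0. A subset of \<open>S\<close> without an
  image in colour 1 then avoids both colours, so it has fewer than \<open>n \<le> N / 25\<close>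
  points, which is less than a fifth of \<open>S\<close>.\<close>

lemma exists_sparse_colour:
  assumes f: "f \<in> [{..<N}]\<^bsup>2\<^esup> \<rightarrow> {..<2::nat}" and N: "25 * n \<le> N" "0 < N"
    and no_clique: "\<And>i. i < 2 \<Longrightarrow> \<not> maps_to {..<t} ([{..<t::nat}]\<^bsup>2\<^esup>) {..<N} (colour_class f {..<N} i)"
    and un: "unavoidable {..<n::nat} {complete_graph t, (V, E)}"
  obtains S i where "i < 2" "S \<subseteq> {..<N}" "S \<noteq> {}"
    "\<And>T. T \<subseteq> S \<Longrightarrow> \<not> maps_to V E T (colour_class f T i) \<Longrightarrow> 5 * card T \<le> card S"
proof -
  have small: "card T < n"
    if T: "T \<subseteq> {..<N}" "\<And>i. i < 2 \<Longrightarrow> \<not> maps_to V E T (colour_class f T i)" for T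
  proof (rule ccontr)
    assume "\<not> card T < n"
    moreover have finT: "finite T" using T(1) finite_subset by blast
    ultimately obtain \<phi> where "\<phi> ` {..<n} \<subseteq> T" "inj_on \<phi> {..<n}"
      using card_le_inj[of "{..<n}" T] by auto
    then have "unavoidable T {complete_graph t, (V, E)}"
      by (intro unavoidable_inj[OF un, of \<phi>]) (simp_all add: image_subset_iff_funcset)
    moreover have "f \<in> [T]\<^bsup>2\<^esup> \<rightarrow> {..<2}"
      using f nsets_Pi_contra[OF T(1)] by blast
    ultimately obtain i where i: "i < 2" and
      "maps_to {..<t} ([{..<t}]\<^bsup>2\<^esup>) T (colour_class f T i) \<or> maps_to V E T (colour_class f T i)"
      unfolding unavoidable_def by (auto dest!: bspec[of _ _ f])
    then have "maps_to {..<t} ([{..<t}]\<^bsup>2\<^esup>) T (colour_class f T i)"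
      using T(2) by blast
    then have "maps_to {..<t} ([{..<t}]\<^bsup>2\<^esup>) {..<N} (colour_class f {..<N} i)"
      using maps_to_subgraph[OF T(1) colour_class_mono[OF T(1)]] maps_to_trans by blast
    then show False using no_clique[OF i] by blast
  qed
  show ?thesis
  proof (cases "\<forall>T\<subseteq>{..<N}. \<not> maps_to V E T (colour_class f T 0) \<longrightarrow> 5 * card T \<le> N")
    case True
    then show ?thesis
      using that[of 0 "{..<N}"] N(2) by auto
  next
    case False
    then obtain S where S: "S \<subseteq> {..<N}" "\<not> maps_to V E S (colour_class f S 0)" "N < 5 * card S"
      by (auto simp: not_le)
    have "5 * card T \<le> card S" if T: "T \<subseteq> S" "\<not> maps_to V E T (colour_class f T 1)" for T
    proof -
      have "\<not> maps_to V E T (colour_class f T 0)"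
        using S(2) maps_to_subgraph[OF T(1) colour_class_mono[OF T(1)]] maps_to_trans by blast
      then have "card T < n"
        using T S(1) by (intro small) (auto simp: less_2_cases_iff)
      then show ?thesis using S(3) N(1) by linarith
    qed
    moreover have "S \<noteq> {}" using S(3) by auto
    ultimately show ?thesis using that[of 1 S] S(1) by auto
  qed
qed

text \<open>
  Among the graphs covered by \<open>s\<close>-cliques which are unavoidable on \<open>N\<close> points together with
  \<open>K\<^sub>s\<^sub>+\<^sub>1\<close>, take one, \<open>P\<close>, of largest chromatic number. If the pair \<open>K\<^sub>s\<^sub>+\<^sub>1\<close>, \<open>P\<close> were unavoidable
  already on \<open>N / 25\<close> points, then every colouring of \<open>N\<close> points without monochromatic \<open>K\<^sub>s\<^sub>+\<^sub>1\<close>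
  would contain a monochromatic graph of larger fractional chromatic number, and the product of
  all these graphs would contradict the choice of \<open>P\<close>.
\<close>

lemma exists_barely_unavoidable:
  fixes n N :: nat
  assumes s: "2 \<le> s" and N: "25 * n \<le> N"
    and un_s: "unavoidable {..<N} {complete_graph s}"
    and not_un: "\<not> unavoidable {..<N} {complete_graph (Suc s)}"
  obtains V and E :: "nat set set" where "simple_graph V E"
    "maps_to V E {..<Suc s} ([{..<Suc s}]\<^bsup>2\<^esup>)"
    "unavoidable {..<N} {(V, E)}" "\<not> unavoidable {..<n} {(V, E)}"
proof -
  let ?K = "complete_graph (Suc s)"
  define good where "good P \<longleftrightarrow> simple_graph (fst P) (snd P) \<and> fst P \<noteq> {} \<and>
      clique_covered s (fst P) (snd P) \<and> unavoidable {..<N} {?K, P}" for P :: "nat set \<times> nat set set"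
  obtain f0 where f0: "f0 \<in> [{..<N}]\<^bsup>2\<^esup> \<rightarrow> {..<2::nat}"
    "\<And>i. i < 2 \<Longrightarrow> \<not> maps_to {..<Suc s} ([{..<Suc s}]\<^bsup>2\<^esup>) {..<N} (colour_class f0 {..<N} i)"
    using not_un unfolding unavoidable_def by auto
  have "N > 0"
  proof (rule ccontr)
    assume "\<not> N > 0"
    then have "N = 0" by simp
    then obtain i where "maps_to {..<s} ([{..<s}]\<^bsup>2\<^esup>) {} (colour_class f0 {} i)"
      using un_s f0(1) unfolding unavoidable_def by auto
    then show False
      using s unfolding maps_to_complete_graph_iff[OF colour_class_subset] by auto
  qed
  have "good (complete_graph s)"
  proof -
    have "clique_covered s {..<s} ([{..<s}]\<^bsup>2\<^esup>)"
      unfolding clique_covered_def by (intro ballI exI[of _ "{..<s}"]) auto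
    moreover have "unavoidable {..<N} {?K, complete_graph s}"
      using un_s unfolding unavoidable_def by fast
    ultimately show ?thesis
      using s by (simp add: good_def lessThan_empty_iff)
  qed
  \<comment> \<open>This makes the maximum exist: \<open>f0\<close> has no monochromatic
    \<open>Suc s\<close>-clique, so every good graph maps into a class of \<open>f0\<close>.\<close>
  moreover have "chromatic_number V E \<le> N" if "good (V, E)" for V E
  proof -
    have "unavoidable {..<N} {?K, (V, E)}" "simple_graph V E"
      using that by (simp_all add: good_def)
    moreover from this obtain i where "i < 2" "maps_to V E {..<N} (colour_class f0 {..<N} i)"
      using f0 unfolding unavoidable_def by (auto dest!: bspec[of _ _ f0])
    ultimately show ?thesis
      using maps_to_complete[OF _ _ _ colour_class_subset, of V E "{..<N}"] by simp
  qed
  ultimately have "\<exists>P. good P \<and> (\<forall>Q. good Q \<longrightarrow> case_prod chromatic_number Q \<le> case_prod chromatic_number P)"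
    by (intro ex_has_greatest_nat[where k = "complete_graph s" and b = "Suc N"])
      (auto simp: less_Suc_eq_le)
  then obtain V E where good: "good (V, E)"
    and max: "\<And>W D. good (W, D) \<Longrightarrow> chromatic_number W D \<le> chromatic_number V E"
    by (metis case_prod_conv surj_pair)
  define r where "r = chromatic_number V E"
  have VE: "simple_graph V E" "V \<noteq> {}" "clique_covered s V E" "unavoidable {..<N} {?K, (V, E)}"
    using good by (simp_all add: good_def)
  have r: "2 \<le> r"
  proof (rule ccontr)
    assume "\<not> 2 \<le> r"
    then obtain c where c: "graph_hom V E {..<1} ([{..<1::nat}]\<^bsup>2\<^esup>) c"
      using chromatic_number_le_iff[OF VE(1), of 1] unfolding maps_to_def r_def by auto
    obtain v K where "v \<in> V" "v \<in> K" "K \<subseteq> V" "finite K" "card K = s" and KE: "[K]\<^bsup>2\<^esup> \<subseteq> E"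
      using VE(2,3) unfolding clique_covered_def by blast
    moreover from this obtain w where "w \<in> K" "w \<noteq> v"
      using s by (metis card_le_Suc0_iff_eq not_less_eq_eq numeral_2_eq_2)
    ultimately have "v \<in> V" "w \<in> V" "{v, w} \<in> E"
      using subsetD[OF KE, of "{v, w}"] by auto
    then have "{c v, c w} \<in> [{..<1}]\<^bsup>2\<^esup>"
      using c unfolding graph_hom_def by blast
    then show False by auto
  qed
  have "\<not> unavoidable {..<n} {?K, (V, E)}"
  proof
    assume un: "unavoidable {..<n} {?K, (V, E)}"
    define \<Phi> where "\<Phi> W D \<longleftrightarrow> simple_graph W D \<and> clique_covered s W D \<and>
        fractional_chromatic_ge (real (r + 1)) W D" for W :: "nat set" and D
    \<comment> \<open>Restricting to vertex sets inside \<open>{..<N}\<close> makes the family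
      finite.\<close>
    define \<F> where "\<F> = {(W, D). W \<subseteq> {..<N} \<and> D \<subseteq> [W]\<^bsup>2\<^esup> \<and> \<Phi> W D}"
    have found: "\<exists>i<2. \<exists>(W, D)\<in>\<F>. maps_to W D {..<N} (colour_class f {..<N} i)"
      if f: "f \<in> [{..<N}]\<^bsup>2\<^esup> \<rightarrow> {..<2::nat}"
        and no: "\<And>i. i < 2 \<Longrightarrow> \<not> maps_to {..<Suc s} ([{..<Suc s}]\<^bsup>2\<^esup>) {..<N} (colour_class f {..<N} i)"
      for f
    proof -
      obtain S i where S: "i < 2" "S \<subseteq> {..<N}" "S \<noteq> {}"
        "\<And>T. T \<subseteq> S \<Longrightarrow> \<not> maps_to V E T (colour_class f T i) \<Longrightarrow> 5 * card T \<le> card S"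
        using exists_sparse_colour[OF f N \<open>N > 0\<close> no un] by metis
      have finS: "finite S" using S(2) finite_subset by blast
      obtain S' where S': "S' \<subseteq> S" "clique_covered s S' (colour_class f S' i)"
        "fractional_chromatic_ge (chromatic_number V E + 1) S' (colour_class f S' i)"
        using large_fractional_subgraph[OF finS S(3) VE(1-3) r[unfolded r_def] S(4)] by metis
      have S'N: "S' \<subseteq> {..<N}" using S'(1) S(2) by blast
      then have "\<Phi> S' (colour_class f S' i)"
        using S' finite_subset[OF S'N] unfolding \<Phi>_def r_def
        by (simp add: simple_graph_colour_class)
      then have "(S', colour_class f S' i) \<in> \<F>"
        using S'N colour_class_subset[of f S' i] by (simp add: \<F>_def)
      moreover have "maps_to S' (colour_class f S' i) {..<N} (colour_class f {..<N} i)"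
        by (rule maps_to_subgraph[OF S'N colour_class_mono[OF S'N]])
      ultimately show ?thesis using S(1) by blast
    qed
    have "\<F> \<subseteq> Pow {..<N} \<times> Pow (Pow {..<N})"
      by (auto simp: \<F>_def nsets_def)
    then have "finite \<F>"
      by (rule finite_subset) simp
    moreover have "\<F> \<noteq> {}"
      using found[OF f0] by blast
    moreover have "\<Phi> W D" if "(W, D) \<in> \<F>" for W D
      using that by (simp add: \<F>_def)
    moreover have "\<Phi> (tensor_verts W X) (tensor_edges D F)" if "\<Phi> W D" "\<Phi> X F" for W D X F
      using that simple_graph_tensor clique_covered_tensor fractional_chromatic_ge_tensor
        simple_graph_finite unfolding \<Phi>_def by metis
    ultimately obtain W D where WD: "\<Phi> W D" "\<And>X F. (X, F) \<in> \<F> \<Longrightarrow> maps_to W D X F"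
      using finite_product_of_graphs[of \<F> \<Phi>] by metis
    have "unavoidable {..<N} {?K, (W, D)}"
      unfolding unavoidable_def
    proof
      fix f assume f: "f \<in> [{..<N}]\<^bsup>2\<^esup> \<rightarrow> {..<2::nat}"
      show "\<exists>i<2. \<exists>(V, E)\<in>{?K, (W, D)}. maps_to V E {..<N} (colour_class f {..<N} i)"
      proof (cases "\<exists>i<2. maps_to {..<Suc s} ([{..<Suc s}]\<^bsup>2\<^esup>) {..<N} (colour_class f {..<N} i)")
        case False
        then obtain i X F where "i < 2" "(X, F) \<in> \<F>" "maps_to X F {..<N} (colour_class f {..<N} i)"
          using found[OF f] by blast
        then have "i < 2" "maps_to W D {..<N} (colour_class f {..<N} i)"
          using WD(2) maps_to_trans by blast+
        then show ?thesis by blast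
      qed blast
    qed
    moreover have "W \<noteq> {}"
      using WD(1) unfolding \<Phi>_def fractional_chromatic_ge_def by auto
    ultimately have "good (W, D)"
      using WD(1) by (simp add: good_def \<Phi>_def)
    then have "chromatic_number W D \<le> r"
      unfolding r_def by (rule max)
    moreover have "real (r + 1) \<le> real (chromatic_number W D)"
      using WD(1) fractional_chromatic_ge_imp_chromatic_number unfolding \<Phi>_def by blast
    ultimately show False by linarith
  qed
  then obtain f where f: "f \<in> [{..<n}]\<^bsup>2\<^esup> \<rightarrow> {..<2::nat}"
    and no_K: "\<And>i. i < 2 \<Longrightarrow> \<not> maps_to {..<Suc s} ([{..<Suc s}]\<^bsup>2\<^esup>) {..<n} (colour_class f {..<n} i)"
    and no_P: "\<And>i. i < 2 \<Longrightarrow> \<not> maps_to V E {..<n} (colour_class f {..<n} i)"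
    unfolding unavoidable_def by auto
  \<comment> \<open>The first factor makes the product \<open>Suc s\<close>-colourable, however
    large the chromatic number of the second. Either alternative in a colouring receives the product
    through a projection.\<close>
  let ?V = "tensor_verts {..<Suc s} V" and ?E = "tensor_edges ([{..<Suc s}]\<^bsup>2\<^esup>) E"
  show thesis
  proof (rule that)
    show "simple_graph ?V ?E"
      using VE(1) by (intro simple_graph_tensor) auto
    show "maps_to ?V ?E {..<Suc s} ([{..<Suc s}]\<^bsup>2\<^esup>)"
      by (rule maps_to_tensor_left)
    show "unavoidable {..<N} {(?V, ?E)}"
      unfolding unavoidable_def
    proof
      fix g assume "g \<in> [{..<N}]\<^bsup>2\<^esup> \<rightarrow> {..<2::nat}"
      then obtain i where i: "i < 2"
        "maps_to {..<Suc s} ([{..<Suc s}]\<^bsup>2\<^esup>) {..<N} (colour_class g {..<N} i)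
          \<or> maps_to V E {..<N} (colour_class g {..<N} i)"
        using VE(4) unfolding unavoidable_def by (auto dest!: bspec[of _ _ g])
      then have "maps_to ?V ?E {..<N} (colour_class g {..<N} i)"
        using maps_to_trans[OF maps_to_tensor_left] maps_to_trans[OF maps_to_tensor_right] by blast
      then show "\<exists>i<2. \<exists>(V, E)\<in>{(?V, ?E)}. maps_to V E {..<N} (colour_class g {..<N} i)"
        using i(1) by blast
    qed
    show "\<not> unavoidable {..<n} {(?V, ?E)}"
    proof
      assume "unavoidable {..<n} {(?V, ?E)}"
      then obtain i where i: "i < 2" and hom: "maps_to ?V ?E {..<n} (colour_class f {..<n} i)"
        using f unfolding unavoidable_def by auto
      have no_clique: "\<not> [K]\<^bsup>2\<^esup> \<subseteq> colour_class f {..<n} j"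
        if "K \<subseteq> {..<n}" "card K = Suc s" "j < 2" for K j
        using no_K[OF that(3)] that(1,2) finite_subset[OF that(1)]
        unfolding maps_to_complete_graph_iff[OF colour_class_subset] by blast
      have "maps_to V E {..<n} (colour_class f {..<n} i)"
      \<comment> \<open>Since \<open>f\<close> has no \<open>Suc s\<close>-clique in either colour,
        its classes also have no independent set of that size.\<close>
      proof (rule maps_to_of_tensor_complete[OF _ colour_class_subset _ _ VE(3) hom])
        show "card I \<noteq> Suc s" if I: "independent_set {..<n} (colour_class f {..<n} i) I" for I
        proof -
          have "1 - i < 2" by simp
          then show ?thesis
            using independent_set_colour_class[OF f i I] no_clique by blast
        qed
      qed (use no_clique i in auto)
      then show False using no_P[OF i] by blast
    qed
  qed
qed

text \<open>This raises the chromatic number to exactly \<open>k\<close>. As \<open>(X, F)\<close>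
  maps to the new graph, colourings avoiding the former avoid the latter.\<close>

lemma exists_graph_with_chromatic_number:
  fixes N k :: nat
  assumes k: "2 \<le> k" and N: "(k - 1)\<^sup>2 + 1 \<le> N"
    and X: "maps_to X F {..<k} ([{..<k}]\<^bsup>2\<^esup>)" "unavoidable {..<N} {(X, F)}"
  obtains V and E :: "nat set set" where "simple_graph V E" "chromatic_number V E = k"
    "unavoidable {..<N} {(V, E)}" "maps_to X F V E"
proof -
  \<comment> \<open>This \<kappa> exceeds \<open>k - 1\<close>, which forces chromatic number
    \<open>k\<close>; it is at most \<open>k\<close>, which admits the complete graph on
    \<open>k\<close> points; and \<open>\<kappa> * (k - 1) \<le> N\<close>, which admits colour
    classes with independent sets smaller than \<open>k\<close>.\<close>
  define \<kappa> where "\<kappa> = ((real k - 1)\<^sup>2 + 1) / (real k - 1)"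
  have \<kappa>_le: "\<kappa> \<le> real k" and \<kappa>_gr: "real k - 1 < \<kappa>"
    using k by (simp_all add: \<kappa>_def field_simps power2_eq_square)
  have "real ((k - 1)\<^sup>2 + 1) \<le> real N"
    using N by (rule of_nat_mono)
  then have \<kappa>_N: "\<kappa> * (real k - 1) \<le> real N"
    using k by (simp add: \<kappa>_def of_nat_diff)
  have "k \<le> N"
  proof -
    have "k - 1 \<le> (k - 1)\<^sup>2" using k by (intro self_le_power) auto
    then show ?thesis using N k by linarith
  qed
  define \<Phi> where "\<Phi> W D \<longleftrightarrow> simple_graph W D \<and> fractional_chromatic_ge \<kappa> W D \<and> maps_to X F W D"
    for W :: "nat set" and D
  define \<F> where "\<F> = {(W, D). W \<subseteq> {..<N} \<and> D \<subseteq> [W]\<^bsup>2\<^esup> \<and> \<Phi> W D}"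
  have "fractional_chromatic_ge \<kappa> {..<k} ([{..<k}]\<^bsup>2\<^esup>)"
  proof (rule fractional_chromatic_ge_uniform)
    show "{..<k} \<noteq> {}" using k by (simp add: lessThan_empty_iff)
    fix I assume I: "independent_set {..<k} ([{..<k}]\<^bsup>2\<^esup>) I"
    have "card (I \<inter> {..<k}) \<le> Suc 0"
      using I unfolding independent_set_def by (subst card_le_Suc0_iff_eq) auto
    then have "\<kappa> * real (card (I \<inter> {..<k})) \<le> \<kappa> * 1"
      using \<kappa>_gr k by (intro mult_left_mono) auto
    then show "\<kappa> * real (card (I \<inter> {..<k})) \<le> real (card {..<k})"
      using \<kappa>_le by simp
  qed auto
  then have complete: "complete_graph k \<in> \<F>"
    using X(1) \<open>k \<le> N\<close> by (auto simp: \<F>_def \<Phi>_def)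
  have "\<F> \<subseteq> Pow {..<N} \<times> Pow (Pow {..<N})"
    by (auto simp: \<F>_def nsets_def)
  then have "finite \<F>"
    by (rule finite_subset) simp
  moreover have "\<F> \<noteq> {}"
    using complete by blast
  moreover have "\<Phi> W D" if "(W, D) \<in> \<F>" for W D
    using that by (simp add: \<F>_def)
  moreover have "\<Phi> (tensor_verts W Y) (tensor_edges D H)" if "\<Phi> W D" "\<Phi> Y H" for W D Y H
    using that simple_graph_tensor fractional_chromatic_ge_tensor maps_to_tensor
      simple_graph_finite unfolding \<Phi>_def by metis
  ultimately obtain V E where VE: "\<Phi> V E" "\<And>W D. (W, D) \<in> \<F> \<Longrightarrow> maps_to V E W D"
    using finite_product_of_graphs[of \<F> \<Phi>] by metis
  have sg: "simple_graph V E" and XV: "maps_to X F V E" and frac: "fractional_chromatic_ge \<kappa> V E"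
    using VE(1) by (simp_all add: \<Phi>_def)
  have Vk: "maps_to V E {..<k} ([{..<k}]\<^bsup>2\<^esup>)"
    using VE(2) complete by blast
  have "chromatic_number V E = k"
  proof (rule antisym)
    show "chromatic_number V E \<le> k"
      using Vk chromatic_number_le_iff[OF sg] by blast
    show "k \<le> chromatic_number V E"
      using fractional_chromatic_ge_imp_chromatic_number[OF sg frac] \<kappa>_gr by linarith
  qed
  moreover have "unavoidable {..<N} {(V, E)}"
    unfolding unavoidable_def
  proof
    fix f assume f: "f \<in> [{..<N}]\<^bsup>2\<^esup> \<rightarrow> {..<2::nat}"
    have "\<exists>i<2. maps_to V E {..<N} (colour_class f {..<N} i)"
    proof (cases "\<exists>i<2. maps_to {..<k} ([{..<k}]\<^bsup>2\<^esup>) {..<N} (colour_class f {..<N} i)")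
      case True
      then show ?thesis using Vk maps_to_trans by blast
    next
      case False
      have indep: "real (card I) \<le> real k - 1"
        if I: "independent_set {..<N} (colour_class f {..<N} i) I" and i: "i < 2" for I i
      proof (rule ccontr)
        assume "\<not> real (card I) \<le> real k - 1"
        then have "k \<le> card I" by linarith
        then obtain K where K: "K \<subseteq> I" "card K = k" "finite K"
          using obtain_subset_with_card_n by metis
        have "[K]\<^bsup>2\<^esup> \<subseteq> colour_class f {..<N} (1 - i)"
          using nsets_mono[OF K(1), of 2] independent_set_colour_class(2)[OF f i I] by blast
        moreover have "K \<subseteq> {..<N}"
          using K(1) independent_set_colour_class(1)[OF f i I] by blast
        ultimately have "maps_to {..<k} ([{..<k}]\<^bsup>2\<^esup>) {..<N} (colour_class f {..<N} (1 - i))"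
          unfolding maps_to_complete_graph_iff[OF colour_class_subset] using K by blast
        moreover have "1 - i < 2" by simp
        ultimately show False using False by blast
      qed
      obtain i where i: "i < 2" "maps_to X F {..<N} (colour_class f {..<N} i)"
        using X(2) f unfolding unavoidable_def by auto
      have "fractional_chromatic_ge \<kappa> {..<N} (colour_class f {..<N} i)"
      proof (rule fractional_chromatic_ge_uniform)
        show "{..<N} \<noteq> {}" using k \<open>k \<le> N\<close> by (simp add: lessThan_empty_iff)
        fix I assume I: "independent_set {..<N} (colour_class f {..<N} i) I"
        then have "I \<inter> {..<N} = I" by (auto simp: independent_set_def)
        moreover have "\<kappa> * real (card I) \<le> \<kappa> * (real k - 1)"
          using indep[OF I i(1)] \<kappa>_gr k by (intro mult_left_mono) auto
        ultimately show "\<kappa> * real (card (I \<inter> {..<N})) \<le> real (card {..<N})"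
          using \<kappa>_N by simp
      qed auto
      then have "({..<N}, colour_class f {..<N} i) \<in> \<F>"
        using i(2) colour_class_subset[of f "{..<N}" i]
        by (simp add: \<F>_def \<Phi>_def simple_graph_colour_class)
      then show ?thesis using VE(2) i(1) by blast
    qed
    then show "\<exists>i<2. \<exists>(V, E)\<in>{(V, E)}. maps_to V E {..<N} (colour_class f {..<N} i)"
      by blast
  qed
  ultimately show ?thesis using that sg XV by blast
qed

section \<open>The chromatic Ramsey number and homomorphisms\<close>

text \<open>A proper colouring of the host pulls edge colourings of the complete graph on its
  colours back to the host, and carries monochromatic copies to homomorphic images.\<close>

lemma unavoidable_chromatic_number:
  assumes W: "simple_graph W D" and arr: "arrows W D V E" and E: "simple_graph V E"
  shows "unavoidable {..<chromatic_number W D} {(V, E)}"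
  unfolding unavoidable_def
proof
  let ?m = "chromatic_number W D"
  fix f assume f: "f \<in> [{..<?m}]\<^bsup>2\<^esup> \<rightarrow> {..<2::nat}"
  obtain c where c: "graph_hom W D {..<?m} ([{..<?m}]\<^bsup>2\<^esup>) c"
    using chromatic_number_le_iff[OF W, of ?m] unfolding maps_to_def by blast
  have "c ` e \<in> [{..<?m}]\<^bsup>2\<^esup>" if e: "e \<in> D" for e
  proof -
    have "e \<in> [W]\<^bsup>2\<^esup>" using W e by (auto simp: simple_graph_def)
    then obtain u v where "e = {u, v}" "u \<in> W" "v \<in> W" by (rule nsets2_E)
    then show ?thesis using c e unfolding graph_hom_def by auto
  qed
  then have "f \<circ> (`) c \<in> D \<rightarrow> {..<2}"
    using f by auto
  then obtain i V' E' where i: "i < 2" and copy: "graph_copy V' E' V E" "V' \<subseteq> W" "E' \<subseteq> D"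
      "(f \<circ> (`) c) ` E' \<subseteq> {i}"
    using arr unfolding arrows_def by blast
  obtain \<psi> where \<psi>: "bij_betw \<psi> V V'" "E' = (`) \<psi> ` E"
    using copy(1) unfolding graph_copy_def by blast
  have \<psi>W: "\<psi> v \<in> W" if "v \<in> V" for v
    using \<psi>(1) copy(2) that by (auto simp: bij_betw_def)
  have "{c (\<psi> u), c (\<psi> v)} \<in> colour_class f {..<?m} i" if uv: "u \<in> V" "v \<in> V" "{u, v} \<in> E" for u v
  proof -
    have E': "{\<psi> u, \<psi> v} \<in> E'"
      using \<psi>(2) uv(3) by (auto intro: image_eqI[of _ _ "{u, v}"])
    then have "{c (\<psi> u), c (\<psi> v)} \<in> [{..<?m}]\<^bsup>2\<^esup>"
      using c \<psi>W uv copy(3) unfolding graph_hom_def by blast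
    moreover have "f {c (\<psi> u), c (\<psi> v)} = i"
      using copy(4) E' by fastforce
    ultimately show ?thesis unfolding colour_class_def by blast
  qed
  then have "graph_hom V E {..<?m} (colour_class f {..<?m} i) (c \<circ> \<psi>)"
    using c \<psi>W unfolding graph_hom_def by auto
  then show "\<exists>i<2. \<exists>(V, E)\<in>{(V, E)}. maps_to V E {..<?m} (colour_class f {..<?m} i)"
    using i unfolding maps_to_def by blast
qed

lemma chromatic_ramsey_number_gt:
  assumes E: "simple_graph V E" and not_un: "\<not> unavoidable {..<n} {(V, E)}"
  shows "n < chromatic_ramsey_number V E"
proof -
  obtain W :: "nat set" and D where "simple_graph W D"
      "chromatic_number W D = chromatic_ramsey_number V E" "arrows W D V E"
    using LeastI_ex[OF chromatic_ramsey_number_exists[OF E]]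
    unfolding chromatic_ramsey_number_def by blast
  then have "unavoidable {..<chromatic_ramsey_number V E} {(V, E)}"
    using unavoidable_chromatic_number[of W D V E] E by simp
  then show ?thesis
    using not_un unavoidable_mono by (metis not_le)
qed

text \<open>
  The host graph is the complete \<open>N\<close>-partite graph on \<open>{..<N * T}\<close> whose parts are the residue
  classes modulo \<open>N\<close>. Ramsey's theorem is applied to the colouring of the pairs \<open>a < b\<close> of
  quotients by the colour patterns of the edges from \<open>N * a + i\<close> to \<open>N * b + j\<close>. The pattern
  depends on the order of \<open>a\<close> and \<open>b\<close>, so the \<open>i\<close>-th part of the copy takes its quotients from
  the \<open>i\<close>-th block of the monochromatic set.
\<close>

lemma chromatic_ramsey_number_le:
  fixes V :: "nat set"
  assumes E: "simple_graph V E" and un: "unavoidable {..<N} {(V, E)}" and N: "0 < N"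
  shows "chromatic_ramsey_number V E \<le> N"
proof -
  define g where "g = card V"
  define Q where "Q = Suc (N * g)"
  define I where "I = {..<N} \<times> {..<N}"
  define P where "P = I \<rightarrow>\<^sub>E {..<2::nat}"
  have "finite P" by (simp add: P_def I_def finite_PiE)
  then obtain enc where enc: "bij_betw enc P {..<card P}"
    using ex_bij_betw_finite_nat[of P] by (auto simp: lessThan_atLeast0)
  obtain T :: nat where T: "partn_lst {..<T} (replicate (card P) Q) 2"
    using ramsey_full by blast
  define W where "W = {..<N * T}"
  define D where "D = {e \<in> [W]\<^bsup>2\<^esup>. \<exists>x\<in>e. \<exists>y\<in>e. x mod N \<noteq> y mod N}"
  have D_iff: "{x, y} \<in> D \<longleftrightarrow> x \<in> W \<and> y \<in> W \<and> x mod N \<noteq> y mod N" for x y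
    by (auto simp: D_def)
  have in_W: "N * a + i \<in> W" if "i < N" "a < T" for a i
  proof -
    have "N * a + i < N * Suc a" using that by simp
    also have "\<dots> \<le> N * T" using that(2) by (intro mult_left_mono) auto
    finally show ?thesis by (simp add: W_def)
  qed
  have sgD: "simple_graph W D"
    by (auto simp: simple_graph_def D_def W_def)
  have "arrows W D V E"
    unfolding arrows_def
  proof
    fix f :: "nat set \<Rightarrow> nat" assume f: "f \<in> D \<rightarrow> {..<2}"
    \<comment> \<open>Pairs outside \<open>D\<close>, such as those within one part, get the default
      colour 0, which keeps all patterns in the finite set \<open>P\<close>.\<close>
    define f' where "f' e = (if e \<in> D then f e else 0)" for e
    have f'2: "f' e < 2" for e using f by (auto simp: f'_def)
    define pat where "pat e = restrict (\<lambda>(i, j). f' {N * Min e + i, N * Max e + j}) I" for e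
    have pat: "pat e \<in> P" for e
      using f'2 by (auto simp: pat_def P_def)
    then have "enc \<circ> pat \<in> [{..<T}]\<^bsup>2\<^esup> \<rightarrow> {..<card P}"
      using enc by (auto simp: bij_betw_def)
    then obtain l H where H: "H \<in> [{..<T}]\<^bsup>Q\<^esup>" and mono: "(enc \<circ> pat) ` [H]\<^bsup>2\<^esup> \<subseteq> {l}"
        and l: "l < card P"
      using partn_lstE[OF T] by (metis length_replicate nth_replicate)
    obtain F where F: "F \<in> P" "enc F = l"
      using enc l by (metis bij_betw_def imageE lessThan_iff)
    have patF: "pat e = F" if "e \<in> [H]\<^bsup>2\<^esup>" for e
      using mono that F pat enc by (auto simp: bij_betw_def inj_on_def)
    have finH: "finite H" and cardH: "card H = Q" and HT: "H \<subseteq> {..<T}"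
      using H by (auto simp: nsets_def)
    obtain en where en: "bij_betw en {..<Q} H" "strict_mono_on {..<Q} en"
      using ex_bij_betw_strict_mono_card[OF finH] cardH by metis
    \<comment> \<open>\<open>F\<close> is the common pattern on \<open>H\<close>. For
      \<open>i < j\<close> its entry at \<open>(i, j)\<close> is the colour of edges from part
      \<open>i\<close> to part \<open>j\<close> when the quotient increases too.\<close>
    define c where "c e = F (Min e, Max e)" for e
    have "c \<in> [{..<N}]\<^bsup>2\<^esup> \<rightarrow> {..<2}"
    proof
      fix e assume e: "e \<in> [{..<N}]\<^bsup>2\<^esup>"
      then have "Min e \<in> e" "Max e \<in> e" "e \<subseteq> {..<N}"
        by (auto simp: nsets_def intro!: Min_in Max_in)
      then have "(Min e, Max e) \<in> I" by (auto simp: I_def)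
      then show "c e \<in> {..<2}" using F(1) by (auto simp: c_def P_def)
    qed
    then obtain t where t: "t < 2" "maps_to V E {..<N} (colour_class c {..<N} t)"
      using un unfolding unavoidable_def by auto
    then obtain \<phi> where \<phi>: "graph_hom V E {..<N} (colour_class c {..<N} t) \<phi>"
      unfolding maps_to_def by blast
    obtain b where b: "bij_betw b V {..<g}"
      using ex_bij_betw_finite_nat[OF simple_graph_finite[OF E]]
      by (auto simp: g_def lessThan_atLeast0)
    \<comment> \<open>\<open>\<phi> v\<close> selects a block of length \<open>g\<close> and
      \<open>b v\<close> the place in it. Later parts thus get larger quotients, and different
      vertices different images.\<close>
    define idx where "idx v = \<phi> v * g + b v" for v
    define \<psi> where "\<psi> v = N * en (idx v) + \<phi> v" for v
    have \<phi>N: "\<phi> v < N" and bg: "b v < g" if "v \<in> V" for v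
      using \<phi> b that unfolding graph_hom_def by (auto simp: bij_betw_def)
    have idx_lt: "idx u < idx v" if "u \<in> V" "v \<in> V" "\<phi> u < \<phi> v" for u v
    proof -
      have "idx u < \<phi> u * g + g" using bg[OF that(1)] by (simp add: idx_def)
      also have "\<dots> = Suc (\<phi> u) * g" by simp
      also have "\<dots> \<le> \<phi> v * g" using that(3) by (intro mult_right_mono) auto
      finally show ?thesis by (simp add: idx_def)
    qed
    have idxQ: "idx v < Q" if "v \<in> V" for v
    proof -
      have "idx v < \<phi> v * g + g" using bg[OF that] by (simp add: idx_def)
      also have "\<dots> = Suc (\<phi> v) * g" by simp
      also have "\<dots> \<le> N * g" using \<phi>N[OF that] by (intro mult_right_mono) auto
      finally show ?thesis by (simp add: Q_def)
    qed
    have enH: "en (idx v) \<in> H" if "v \<in> V" for v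
      using en(1) idxQ[OF that] by (auto simp: bij_betw_def)
    have \<psi>W: "\<psi> v \<in> W" if "v \<in> V" for v
      using in_W[OF \<phi>N[OF that]] enH[OF that] HT by (auto simp: \<psi>_def)
    have \<psi>_mod: "\<psi> v mod N = \<phi> v" and \<psi>_div: "\<psi> v div N = en (idx v)" if "v \<in> V" for v
      using \<phi>N[OF that] N by (simp_all add: \<psi>_def)
    have inj: "inj_on \<psi> V"
    proof (rule inj_onI)
      fix u v assume uv: "u \<in> V" "v \<in> V" "\<psi> u = \<psi> v"
      then have "\<phi> u = \<phi> v" "en (idx u) = en (idx v)"
        using \<psi>_mod \<psi>_div by metis+
      then have "idx u = idx v"
        using en(1) idxQ uv by (auto simp: bij_betw_def inj_on_def)
      then have "b u = b v" using \<open>\<phi> u = \<phi> v\<close> by (simp add: idx_def)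
      then show "u = v" using b uv by (auto simp: bij_betw_def inj_on_def)
    qed
    have edge_lt: "{\<psi> u, \<psi> v} \<in> D \<and> f {\<psi> u, \<psi> v} = t"
      if uv: "u \<in> V" "v \<in> V" "{u, v} \<in> E" and lt: "\<phi> u < \<phi> v" for u v
    proof -
      have D: "{\<psi> u, \<psi> v} \<in> D"
        using \<psi>W \<psi>_mod uv lt by (simp add: D_iff)
      have en_lt: "en (idx u) < en (idx v)"
        using en(2) idx_lt[OF uv(1,2) lt] idxQ uv by (simp add: strict_mono_on_def)
      let ?e = "{en (idx u), en (idx v)}"
      have "?e \<in> [H]\<^bsup>2\<^esup>" using enH uv en_lt by simp
      then have "pat ?e (\<phi> u, \<phi> v) = F (\<phi> u, \<phi> v)" by (simp add: patF)
      moreover have "pat ?e (\<phi> u, \<phi> v) = f' {\<psi> u, \<psi> v}"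
        using en_lt \<phi>N uv by (simp add: pat_def I_def \<psi>_def)
      moreover have "c {\<phi> u, \<phi> v} = F (\<phi> u, \<phi> v)"
        using lt by (simp add: c_def)
      moreover have "c {\<phi> u, \<phi> v} = t"
        using \<phi> uv unfolding graph_hom_def by simp
      ultimately show ?thesis using D by (simp add: f'_def)
    qed
    have edge: "{\<psi> u, \<psi> v} \<in> D \<and> f {\<psi> u, \<psi> v} = t" if uv: "u \<in> V" "v \<in> V" "{u, v} \<in> E" for u v
    proof -
      have "\<phi> u \<noteq> \<phi> v" using \<phi> uv unfolding graph_hom_def by simp
      then show ?thesis
        using edge_lt[OF uv] edge_lt[of v u] uv by (auto simp: insert_commute neq_iff)
    qed
    have image_edge: "\<psi> ` e \<in> D \<and> f (\<psi> ` e) = t" if e: "e \<in> E" for e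
    proof -
      have "e \<in> [V]\<^bsup>2\<^esup>" using E e by (auto simp: simple_graph_def)
      then obtain u v where "e = {u, v}" "u \<in> V" "v \<in> V" by (rule nsets2_E)
      then show ?thesis using edge e by simp
    qed
    have "graph_copy (\<psi> ` V) ((`) \<psi> ` E) V E"
      unfolding graph_copy_def using inj by (intro exI[of _ \<psi>]) (simp add: bij_betw_def)
    moreover have "\<psi> ` V \<subseteq> W" "(`) \<psi> ` E \<subseteq> D" "f ` (`) \<psi> ` E \<subseteq> {t}"
      using \<psi>W image_edge by auto
    ultimately show "\<exists>i<2. \<exists>V' E'. graph_copy V' E' V E \<and> V' \<subseteq> W \<and> E' \<subseteq> D \<and> f ` E' \<subseteq> {i}"
      using t(1) by blast
  qed
  then have "chromatic_ramsey_number V E \<le> chromatic_number W D"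
    unfolding chromatic_ramsey_number_def using sgD by (intro Least_le) blast
  moreover have "graph_hom W D {..<N} ([{..<N}]\<^bsup>2\<^esup>) (\<lambda>x. x mod N)"
    using N unfolding graph_hom_def by (auto simp: D_iff)
  then have "chromatic_number W D \<le> N"
    using chromatic_number_le_iff[OF sgD] unfolding maps_to_def by blast
  ultimately show ?thesis by linarith
qed

section \<open>Classical Ramsey numbers\<close>

lemma ramsey_number_le: "ramsey_number k \<le> 4 ^ k"
proof -
  have "partn_lst {..<ES 2 k k} [k, k] 2"
    by (rule ramsey2_full)
  then have "ramsey_number k \<le> (k + k) choose k"
    unfolding ramsey_number_def by (intro Least_le) (simp add: partn_lst_eq_partn ES2_choose)
  also have "\<dots> \<le> (\<Sum>i\<le>k + k. (k + k) choose i)"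
    by (rule member_le_sum) auto
  also have "\<dots> = 4 ^ k"
    by (simp add: choose_row_sum power_add flip: power_mult_distrib)
  finally show ?thesis .
qed

lemma unavoidable_ramsey_number:
  "unavoidable {..<N} {complete_graph k} \<longleftrightarrow> ramsey_number k \<le> N"
proof
  assume "unavoidable {..<N} {complete_graph k}"
  then show "ramsey_number k \<le> N"
    unfolding ramsey_number_def by (intro Least_le) (simp add: partn_iff_unavoidable)
next
  assume "ramsey_number k \<le> N"
  moreover have "unavoidable {..<ramsey_number k} {complete_graph k}"
    using LeastI_ex[OF ramsey_number_exists] unfolding ramsey_number_def
    by (simp add: partn_iff_unavoidable)
  ultimately show "unavoidable {..<N} {complete_graph k}"
    by (rule unavoidable_mono[rotated])
qed

text \<open>A single edge is monochromatic. This ensures \<open>s \<ge> 2\<close> when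
  \<open>Suc s\<close> is the least size of an avoidable clique.\<close>

lemma unavoidable_complete_graph_2:
  fixes N s :: nat
  assumes "2 \<le> N" "s \<le> 2"
  shows "unavoidable {..<N} {complete_graph s}"
  unfolding unavoidable_def
proof
  fix f assume f: "f \<in> [{..<N}]\<^bsup>2\<^esup> \<rightarrow> {..<2::nat}"
  obtain i where i: "f {0, 1} = i" by blast
  have "{0, 1} \<in> [{..<N}]\<^bsup>2\<^esup>" using assms by simp
  then have "i < 2" using funcset_mem[OF f] i by blast
  have "f {u, v} = i" if uv: "u < 2" "v < 2" "u \<noteq> v" for u v
  proof -
    have "u = 0 \<and> v = 1 \<or> u = 1 \<and> v = 0" using uv by linarith
    then show ?thesis using i by (elim disjE conjE) (simp_all add: insert_commute)
  qed
  then have "graph_hom {..<2} ([{..<2}]\<^bsup>2\<^esup>) {..<N} (colour_class f {..<N} i) id"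
    using assms(1) unfolding graph_hom_def by (simp del: nsets_self)
  moreover have "maps_to {..<s} ([{..<s}]\<^bsup>2\<^esup>) {..<2} ([{..<2::nat}]\<^bsup>2\<^esup>)"
    using assms(2) by (intro maps_to_subgraph nsets_mono) auto
  ultimately have "maps_to {..<s} ([{..<s}]\<^bsup>2\<^esup>) {..<N} (colour_class f {..<N} i)"
    using maps_to_trans unfolding maps_to_def by blast
  then show "\<exists>i<2. \<exists>(V, E)\<in>{complete_graph s}. maps_to V E {..<N} (colour_class f {..<N} i)"
    using \<open>i < 2\<close> by blast
qed

lemma exists_chromatic_ramsey_number:
  assumes k: "2 \<le> k" and N: "(k - 1)\<^sup>2 + 1 \<le> N" "N \<le> ramsey_number k"
  obtains V and E :: "nat set set" where "simple_graph V E" "chromatic_number V E = k"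
    "chromatic_ramsey_number V E \<le> N" "N < 25 * chromatic_ramsey_number V E"
proof -
  define n where "n = N div 25"
  have n: "25 * n \<le> N" "N < 25 * Suc n" by (simp_all add: n_def)
  have "1 \<le> (k - 1)\<^sup>2" using k by simp
  then have N2: "2 \<le> N" using N(1) by linarith
  obtain X and F :: "nat set set" where X: "maps_to X F {..<k} ([{..<k}]\<^bsup>2\<^esup>)"
    "unavoidable {..<N} {(X, F)}" "\<not> unavoidable {..<n} {(X, F)}"
  proof (cases "unavoidable {..<N} {complete_graph k}")
    \<comment> \<open>Here \<open>N\<close> equals \<open>ramsey_number k\<close>, and the complete
      graph itself is avoidable on the fewer points \<open>n\<close>.\<close>
    case True
    then have "N = ramsey_number k"
      using N(2) unavoidable_ramsey_number by (metis antisym)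
    then have "\<not> unavoidable {..<n} {complete_graph k}"
      using n N2 unfolding unavoidable_ramsey_number by linarith
    then show ?thesis
      using True by (intro that[of "{..<k}" "[{..<k}]\<^bsup>2\<^esup>"] maps_to_subgraph) simp_all
  next
    case False
    define t where "t = (LEAST t. \<not> unavoidable {..<N} {complete_graph t})"
    have t: "\<not> unavoidable {..<N} {complete_graph t}" "t \<le> k"
      unfolding t_def by (rule LeastI, rule False) (rule Least_le, rule False)
    have "2 < t"
      using t(1) unavoidable_complete_graph_2[OF N2] by (meson not_le)
    then obtain s where s: "t = Suc s" "2 \<le> s"
      by (cases t) auto
    have "unavoidable {..<N} {complete_graph s}"
      using not_less_Least[of s "\<lambda>t. \<not> unavoidable {..<N} {complete_graph t}"] s(1)
      unfolding t_def by auto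
    then obtain X and F :: "nat set set" where XF: "maps_to X F {..<Suc s} ([{..<Suc s}]\<^bsup>2\<^esup>)"
      "unavoidable {..<N} {(X, F)}" "\<not> unavoidable {..<n} {(X, F)}"
      using exists_barely_unavoidable[OF s(2) n(1)] t(1) s(1) by metis
    have "maps_to {..<Suc s} ([{..<Suc s}]\<^bsup>2\<^esup>) {..<k} ([{..<k}]\<^bsup>2\<^esup>)"
      using t(2) s(1) by (intro maps_to_subgraph nsets_mono) auto
    then show ?thesis
      using that[of X F] XF(2,3) maps_to_trans[OF XF(1)] by blast
  qed
  obtain V and E :: "nat set set" where VE: "simple_graph V E" "chromatic_number V E = k"
    "unavoidable {..<N} {(V, E)}" "maps_to X F V E"
    using exists_graph_with_chromatic_number[OF k N(1) X(1,2)] by metis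
  have "unavoidable {..<n} {(X, F)}" if "unavoidable {..<n} {(V, E)}"
    using that maps_to_trans[OF VE(4)] unfolding unavoidable_def by simp blast
  then have "n < chromatic_ramsey_number V E"
    using X(3) chromatic_ramsey_number_gt[OF VE(1)] by blast
  moreover have "chromatic_ramsey_number V E \<le> N"
    using chromatic_ramsey_number_le[OF VE(1,3)] N2 by simp
  ultimately show ?thesis
    using that[OF VE(1,2)] n(2) by simp
qed

theorem theorem1p4:
  shows "\<exists>C::real. C > 0 \<and>
    (\<forall>(k::nat) (\<gamma>::real).
       k \<ge> 2 \<longrightarrow> (real k - 1)^2 + 1 \<le> \<gamma> \<longrightarrow> \<gamma> \<le> real (ramsey_number k) \<longrightarrow>
       (\<exists>(V::nat set) E.
          simple_graph V E \<and> chromatic_number V E = k \<and>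
          C * \<gamma> * max (log 2 \<gamma> / (real k * log 2 (real k))) ((log 2 \<gamma> / real k)^2)
            < real (chromatic_ramsey_number V E) \<and>
          real (chromatic_ramsey_number V E) \<le> \<gamma>))"
proof (intro exI[of _ "1 / 200"] conjI allI impI)
  fix k :: nat and \<gamma> :: real
  assume k: "2 \<le> k" and lower: "(real k - 1)^2 + 1 \<le> \<gamma>" and upper: "\<gamma> \<le> real (ramsey_number k)"
  define N where "N = nat \<lfloor>\<gamma>\<rfloor>"
  have \<gamma>1: "1 \<le> \<gamma>"
    using lower by (smt (verit) zero_le_power2)
  have N\<gamma>: "real N \<le> \<gamma>" "\<gamma> < real N + 1"
    using \<gamma>1 unfolding N_def by linarith+
  have "real ((k - 1)\<^sup>2 + 1) < real N + 1"
    using lower N\<gamma>(2) k by (simp add: of_nat_diff)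
  then have "(k - 1)\<^sup>2 + 1 \<le> N" by linarith
  moreover have "N \<le> ramsey_number k"
    using N\<gamma>(1) upper by linarith
  ultimately obtain V and E :: "nat set set" where VE: "simple_graph V E" "chromatic_number V E = k"
    "chromatic_ramsey_number V E \<le> N" "N < 25 * chromatic_ramsey_number V E"
    using exists_chromatic_ramsey_number[OF k] by metis
  have "log 2 \<gamma> \<le> log 2 (4 ^ k)"
  proof (subst log_le_cancel_iff)
    have "real (ramsey_number k) \<le> real (4 ^ k)"
      using ramsey_number_le by (rule of_nat_mono)
    then have "\<gamma> \<le> real (4 ^ k)" using upper by (rule order_trans[rotated])
    then show "\<gamma> \<le> 4 ^ k" by simp
  qed (use \<gamma>1 in auto)
  also have "log 2 (4 ^ k) = 2 * real k"
    using log_nat_power[of 4 2 k] log_nat_power[of 2 2 2] by simp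
  finally have log_le: "log 2 \<gamma> / real k \<le> 2"
    using k by (simp add: field_simps)
  have log_ge: "0 \<le> log 2 \<gamma> / real k"
    using \<gamma>1 by simp
  have "1 \<le> log 2 (real k)"
    using k by (simp add: le_log_iff)
  then have "log 2 \<gamma> / real k / log 2 (real k) \<le> log 2 \<gamma> / real k / 1"
    using log_ge by (intro divide_left_mono) auto
  then have "log 2 \<gamma> / (real k * log 2 (real k)) \<le> 4"
    using log_le by simp
  moreover have "(log 2 \<gamma> / real k)^2 \<le> 2^2"
    using log_le log_ge by (rule power_mono)
  ultimately have "max (log 2 \<gamma> / (real k * log 2 (real k))) ((log 2 \<gamma> / real k)^2) \<le> 4"
    by simp
  \<comment> \<open>The constant is \<open>1 / (4 * 50)\<close>: the maximum is at most 4, and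
    \<gamma> is less than 50 times the chromatic Ramsey number.\<close>
  then have "1 / 200 * \<gamma> * max (log 2 \<gamma> / (real k * log 2 (real k))) ((log 2 \<gamma> / real k)^2)
      \<le> 1 / 200 * \<gamma> * 4"
    using \<gamma>1 by (intro mult_left_mono) auto
  moreover have "\<gamma> < 50 * real (chromatic_ramsey_number V E)"
    using VE(4) N\<gamma>(2) \<gamma>1 by linarith
  ultimately have "1 / 200 * \<gamma> * max (log 2 \<gamma> / (real k * log 2 (real k))) ((log 2 \<gamma> / real k)^2)
      < real (chromatic_ramsey_number V E)"
    by linarith
  moreover have "real (chromatic_ramsey_number V E) \<le> \<gamma>"
    using VE(3) N\<gamma>(1) by linarith
  ultimately show "\<exists>(V::nat set) E. simple_graph V E \<and> chromatic_number V E = k \<and>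
      1 / 200 * \<gamma> * max (log 2 \<gamma> / (real k * log 2 (real k))) ((log 2 \<gamma> / real k)^2)
        < real (chromatic_ramsey_number V E) \<and>
      real (chromatic_ramsey_number V E) \<le> \<gamma>"
    using VE(1,2) by blast
qed simp

end
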